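(* The indefinite octonionic projective plane $\mathbb OP^{(1,1)}$ (with the metric below) is a special Osserman manifold.
   Context: Octonions $\mathbb O=\mathbb H\oplus\mathbb H$ with product $(q_1,q_2)(p_1,p_2)=(q_1p_1-\bar p_2q_2,\ p_2q_1+q_2\bar p_1)$, conjugation $\overline{(q_1,q_2)}=(\bar q_1,-q_2)$, $\langle a,b\rangle=\mathrm{Re}(a\bar b)$, $|a|^2=\langle a,a\rangle$. $\mathbb OP^{(1,1)}=(U_1\cup U_2)/_\sim$ with $U_1=\{(1,u,v):1+|u|^2-|v|^2>0\}$, $U_2=\{(u,1,v):|u|^2+1-|v|^2>0\}$, $[a,b,c]\sim[d,e,f]$ iff $(a,b,c)=(d\lambda,e\lambda,f\lambda)$ for some $\lambda\ne0$; charts $[1,u,v]\mapsto(u,v)$, $[u,1,v]\mapsto(u,v)$; metric of signature $(8,8)$ on each chart, for tangent vector $(du,dv)=(\xi,\eta)$: $ds^2=\frac{|\xi|^2(1-|v|^2)-|\eta|^2(1+|u|^2)+2\mathrm{Re}[(u\bar v)(\eta\bar\xi)]}{(1+|u|^2-|v|^2)^2}$. For a semi-Riemannian manifold with curvature $(1,3)$-tensor $R$ (convention: $g(R(X,Y)Z,W)=R(X,Y,Z,W)$ where in coordinates with vanishing first metric derivatives $R_{\alpha\beta\gamma\delta}=\tfrac12[\partial_\alpha\partial_\delta g_{\beta\gamma}+\partial_\beta\partial_\gamma g_{\alpha\delta}-\partial_\beta\partial_\delta g_{\alpha\gamma}-\partial_\alpha\partial_\gamma g_{\beta\delta}]$),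 the Jacobi operator is $\mathcal J_v(x)=R(v,x)v$. For unit $v$ ($\varepsilon_v:=g(v,v)=\pm1$), the manifold is special Osserman if there are real numbers $\lambda\ne\mu$, both nonzero, such that at every point and for every unit $v$: (I) $\mathcal J_v|_{v^\perp}$ is diagonalizable with exactly the two nonzero eigenvalues $\varepsilon_v\lambda,\varepsilon_v\mu$; (II) with $E_\lambda(v)=\mathrm{span}\{v\}\oplus\ker(\mathcal J_v-\varepsilon_v\lambda\mathrm{Id})$, every unit $w\in E_\lambda(v)$ has $E_\lambda(w)=E_\lambda(v)$; (III) if $w$ is unit and $w\in\ker(\mathcal J_v-\varepsilon_v\mu\mathrm{Id})$ then $v\in\ker(\mathcal J_w-\varepsilon_w\mu\mathrm{Id})$. *)

theory Defs
  imports "HOL-Analysis.Analysis"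
begin

type_synonym quat = "real \<times> real \<times> real \<times> real"

definition qmul :: "quat \<Rightarrow> quat \<Rightarrow> quat" where
  "qmul p q = (case p of (a1, b1, c1, d1) \<Rightarrow> (case q of (a2, b2, c2, d2) \<Rightarrow>
     (a1*a2 - b1*b2 - c1*c2 - d1*d2,
      a1*b2 + b1*a2 + c1*d2 - d1*c2,
      a1*c2 - b1*d2 + c1*a2 + d1*b2,
      a1*d2 + b1*c2 - c1*b2 + d1*a2)))"

definition qconj :: "quat \<Rightarrow> quat" where
  "qconj p = (case p of (a, b, c, d) \<Rightarrow> (a, -b, -c, -d))"

definition qre :: "quat \<Rightarrow> real" where
  "qre p = fst p"

type_synonym oct = "quat \<times> quat"

definition omul :: "oct \<Rightarrow> oct \<Rightarrow> oct" where
  "omul a b = (case a of (q1, q2) \<Rightarrow> (case b of (p1, p2) \<Rightarrow>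
     (qmul q1 p1 - qmul (qconj p2) q2, qmul p2 q1 + qmul q2 (qconj p1))))"

definition oconj :: "oct \<Rightarrow> oct" where
  "oconj a = (case a of (q1, q2) \<Rightarrow> (qconj q1, - q2))"

definition ore :: "oct \<Rightarrow> real" where
  "ore a = qre (fst a)"

definition oinner :: "oct \<Rightarrow> oct \<Rightarrow> real" where
  "oinner a b = ore (omul a (oconj b))"

definition onorm2 :: "oct \<Rightarrow> real" where
  "onorm2 a = oinner a a"

text \<open>Both charts [1,u,v] and [u,1,v] have the same image set and the same metric formula.\<close>
definition OP11_dom :: "(oct \<times> oct) set" where
  "OP11_dom = {(u, v). 1 + onorm2 u - onorm2 v > 0}"

definition OP11_ds2 :: "oct \<times> oct \<Rightarrow> oct \<times> oct \<Rightarrow> real" where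
  "OP11_ds2 p X = (case p of (u, v) \<Rightarrow> (case X of (\<xi>, \<eta>) \<Rightarrow>
     (onorm2 \<xi> * (1 - onorm2 v) - onorm2 \<eta> * (1 + onorm2 u)
       + 2 * ore (omul (omul u (oconj v)) (omul \<eta> (oconj \<xi>))))
     / (1 + onorm2 u - onorm2 v)^2))"

definition OP11_metric :: "oct \<times> oct \<Rightarrow> oct \<times> oct \<Rightarrow> oct \<times> oct \<Rightarrow> real" where
  "OP11_metric p X Y = (OP11_ds2 p (X + Y) - OP11_ds2 p (X - Y)) / 4"

text \<open>g p X Y is the metric at point p on tangent vectors X, Y (constant vector fields).\<close>

definition dirD :: "('a::real_vector \<Rightarrow> real) \<Rightarrow> 'a \<Rightarrow> 'a \<Rightarrow> real" where
  "dirD f p X = deriv (\<lambda>t. f (p + t *\<^sub>R X)) 0"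

definition dirD2 :: "('a::real_vector \<Rightarrow> real) \<Rightarrow> 'a \<Rightarrow> 'a \<Rightarrow> 'a \<Rightarrow> real" where
  "dirD2 f p X W = deriv (\<lambda>s. deriv (\<lambda>t. f (p + s *\<^sub>R X + t *\<^sub>R W)) 0) 0"

text \<open>Levi-Civita connection on constant fields: g(nabla_X Y, Z) by the Koszul formula.\<close>
definition christ :: "('a::real_vector \<Rightarrow> 'a \<Rightarrow> 'a \<Rightarrow> real) \<Rightarrow> 'a \<Rightarrow> 'a \<Rightarrow> 'a \<Rightarrow> 'a" where
  "christ g p X Y = (THE w. \<forall>Z. g p w Z =
     (dirD (\<lambda>q. g q Y Z) p X + dirD (\<lambda>q. g q X Z) p Y - dirD (\<lambda>q. g q X Y) p Z) / 2)"

text \<open>Curvature 4-tensor R(X,Y,Z,W) = g(R(X,Y)Z,W), with the sign convention of the paper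
  (second-derivative part as given; the Christoffel part is the one forced by the Levi-Civita
  connection for that convention).\<close>
definition curv4 :: "('a::real_vector \<Rightarrow> 'a \<Rightarrow> 'a \<Rightarrow> real) \<Rightarrow> 'a \<Rightarrow> 'a \<Rightarrow> 'a \<Rightarrow> 'a \<Rightarrow> 'a \<Rightarrow> real" where
  "curv4 g p X Y Z W =
     (dirD2 (\<lambda>q. g q Y Z) p X W + dirD2 (\<lambda>q. g q X W) p Y Z
      - dirD2 (\<lambda>q. g q X Z) p Y W - dirD2 (\<lambda>q. g q Y W) p X Z) / 2
     + g p (christ g p Y Z) (christ g p X W) - g p (christ g p X Z) (christ g p Y W)"

definition curvop :: "('a::real_vector \<Rightarrow> 'a \<Rightarrow> 'a \<Rightarrow> real) \<Rightarrow> 'a \<Rightarrow> 'a \<Rightarrow> 'a \<Rightarrow> 'a \<Rightarrow> 'a" where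
  "curvop g p X Y Z = (THE w. \<forall>W. g p w W = curv4 g p X Y Z W)"

definition jacobi :: "('a::real_vector \<Rightarrow> 'a \<Rightarrow> 'a \<Rightarrow> real) \<Rightarrow> 'a \<Rightarrow> 'a \<Rightarrow> 'a \<Rightarrow> 'a" where
  "jacobi g p v x = curvop g p v x v"

definition unitv :: "('a::real_vector \<Rightarrow> 'a \<Rightarrow> 'a \<Rightarrow> real) \<Rightarrow> 'a \<Rightarrow> 'a \<Rightarrow> bool" where
  "unitv g p v \<longleftrightarrow> g p v v = 1 \<or> g p v v = -1"

definition eigsp :: "('a::real_vector \<Rightarrow> 'a \<Rightarrow> 'a \<Rightarrow> real) \<Rightarrow> 'a \<Rightarrow> 'a \<Rightarrow> real \<Rightarrow> 'a set" where
  "eigsp g p v c = {x. jacobi g p v x = c *\<^sub>R x}"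

definition vperp :: "('a::real_vector \<Rightarrow> 'a \<Rightarrow> 'a \<Rightarrow> real) \<Rightarrow> 'a \<Rightarrow> 'a \<Rightarrow> 'a set" where
  "vperp g p v = {x. g p v x = 0}"

definition Elam :: "('a::real_vector \<Rightarrow> 'a \<Rightarrow> 'a \<Rightarrow> real) \<Rightarrow> 'a \<Rightarrow> real \<Rightarrow> 'a \<Rightarrow> 'a set" where
  "Elam g p lam v = {a *\<^sub>R v + x | a x. x \<in> eigsp g p v (g p v v * lam)}"

definition osserman_I :: "('a::real_vector \<Rightarrow> 'a \<Rightarrow> 'a \<Rightarrow> real) \<Rightarrow> 'a \<Rightarrow> real \<Rightarrow> real \<Rightarrow> 'a \<Rightarrow> bool" where
  "osserman_I g p lam mu v \<longleftrightarrow>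
     (let e = g p v v;
          A = eigsp g p v (e * lam) \<inter> vperp g p v;
          B = eigsp g p v (e * mu) \<inter> vperp g p v
      in (\<forall>x \<in> vperp g p v. \<exists>y z. y \<in> A \<and> z \<in> B \<and> x = y + z)
         \<and> (\<exists>y \<in> A. y \<noteq> 0) \<and> (\<exists>z \<in> B. z \<noteq> 0))"

definition special_osserman :: "('a::real_vector \<Rightarrow> 'a \<Rightarrow> 'a \<Rightarrow> real) \<Rightarrow> 'a set \<Rightarrow> bool" where
  "special_osserman g D \<longleftrightarrow>
     (\<exists>lam mu. lam \<noteq> mu \<and> lam \<noteq> 0 \<and> mu \<noteq> 0 \<and>
       (\<forall>p \<in> D. \<forall>v. unitv g p v \<longrightarrow>
          osserman_I g p lam mu v
          \<and> (\<forall>w. unitv g p w \<and> w \<in> Elam g p lam v \<longrightarrow> Elam g p lam w = Elam g p lam v)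
          \<and> (\<forall>w. unitv g p w \<and> w \<in> eigsp g p v (g p v v * mu)
                  \<longrightarrow> v \<in> eigsp g p w (g p w w * mu))))"

end

theory Submission
  imports Defs
begin

text \<open>
  Write \<open>h(X,Y) = \<langle>X\<^sub>1,Y\<^sub>1\<rangle> - \<langle>X\<^sub>2,Y\<^sub>2\<rangle>\<close>, \<open>D(q) = 1 + h(q,q)\<close>, and let \<open>P(A,A;X,X)\<close> be the octonionic
  substitute \<open>|A\<^sub>1|\<^sup>2|X\<^sub>1|\<^sup>2 + |A\<^sub>2|\<^sup>2|X\<^sub>2|\<^sup>2 - 2\<langle>A\<^sub>1 A\<^sub>2*, X\<^sub>1 X\<^sub>2*\<rangle>\<close> for the squared modulus of
  a Hermitian product. The metric is \<open>h/D - P(q,q;-,-)/D\<^sup>2\<close>, so linear maps that preserve \<open>h\<close> and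
  \<open>P\<close> are isometries; triality provides enough of them to move any point to one with both
  coordinates real. At a real point \<open>(r,s)\<close> put \<open>c(X) = r X\<^sub>1 - s X\<^sub>2\<close>. As in the Fubini-Study case
  the Christoffel symbols are \<open>- (X c(Y) + Y c(X))/D\<close>, and the alternative laws suffice to compute
  \<open>R(v,x,v,x) = g(v,v) g(x,x) - 4 g(v,x)\<^sup>2 + 3 P(Fv,Fv;Fx,Fx)\<close>, where \<open>F\<close> is a linear map carrying
  \<open>g\<close> to \<open>h\<close>. Hence in the frame \<open>F\<close> the Jacobi operator is \<open>x \<mapsto> \<epsilon> x - 4 h(v,x) v + 3 P\<^sub>v x\<close>,
  where \<open>\<epsilon> P\<^sub>v\<close> is the orthogonal projection onto the octonionic line through \<open>v\<close>. Its eigenvalues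
  on the complement of \<open>v\<close> are \<open>4 \<epsilon>\<close> (on the line) and \<open>\<epsilon>\<close> (orthogonally to it), and all three
  conditions become statements about octonionic lines.
\<close>

subsection \<open>Octonions\<close>

notation omul (infixl "\<odot>" 70)

text \<open>Octonions and tangent vectors are nested pairs; quantifiers over them should stay whole
  rather than dissolve into real coordinates.\<close>

declare split_paired_All [simp del] split_paired_Ex [simp del]

definition o1 :: oct where "o1 = ((1, 0, 0, 0), 0)"

lemmas oct_defs = omul_def qmul_def oconj_def qconj_def case_prod_beta prod_eq_iff

lemma oinner_eq_inner: "oinner a b = a \<bullet> b"
  by (simp add: oinner_def ore_def qre_def oct_defs inner_prod_def)

lemma onorm2_eq_inner: "onorm2 a = a \<bullet> a"
  by (simp add: onorm2_def oinner_eq_inner)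

lemma omul_add_left: "(a + b) \<odot> c = a \<odot> c + b \<odot> c"
  by (simp add: oct_defs algebra_simps)

lemma omul_add_right: "c \<odot> (a + b) = c \<odot> a + c \<odot> b"
  by (simp add: oct_defs algebra_simps)

lemma omul_scaleR_left: "(k *\<^sub>R a) \<odot> c = k *\<^sub>R (a \<odot> c)"
  by (simp add: oct_defs algebra_simps)

lemma omul_scaleR_right: "c \<odot> (k *\<^sub>R a) = k *\<^sub>R (c \<odot> a)"
  by (simp add: oct_defs algebra_simps)

lemma oconj_add: "oconj (a + b) = oconj a + oconj b"
  by (simp add: oct_defs)

lemma oconj_scaleR: "oconj (k *\<^sub>R a) = k *\<^sub>R oconj a"
  by (simp add: oct_defs)

lemma oconj_oconj: "oconj (oconj a) = a"
  by (simp add: oct_defs)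

lemma inner_oconj: "oconj a \<bullet> oconj b = a \<bullet> b"
  by (simp add: oct_defs inner_prod_def)

lemma oconj_omul: "oconj (a \<odot> b) = oconj b \<odot> oconj a"
  by (simp add: oct_defs algebra_simps)

lemma oconj_eq: "oconj a = (2 * (a \<bullet> o1)) *\<^sub>R o1 - a"
  by (simp add: oct_defs inner_prod_def o1_def zero_prod_def)

lemma omul_o1 [simp]: "a \<odot> o1 = a" "o1 \<odot> a = a" "oconj o1 = o1"
  by (simp_all add: oct_defs o1_def zero_prod_def)

lemma inner_omul_left: "(a \<odot> b) \<bullet> c = b \<bullet> (oconj a \<odot> c)"
  by (simp add: oct_defs inner_prod_def algebra_simps)

lemma inner_omul_right: "(a \<odot> b) \<bullet> c = a \<bullet> (c \<odot> oconj b)"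
  by (simp add: oct_defs inner_prod_def algebra_simps)

lemma inner_omul_oconj_o1: "(a \<odot> oconj b) \<bullet> o1 = a \<bullet> b" "o1 \<bullet> (a \<odot> oconj b) = a \<bullet> b"
  by (simp_all add: inner_omul_right oconj_oconj inner_commute[of o1])

text \<open>Left alternativity in conjugate form, checked on coordinates. Together with its mirror
  image below it stands in for associativity.\<close>

lemma oconj_omul_cancel: "oconj a \<odot> (a \<odot> b) = (a \<bullet> a) *\<^sub>R b"
  by (simp add: oct_defs inner_prod_def algebra_simps)

lemma omul_oconj_cancel: "(b \<odot> a) \<odot> oconj a = (a \<bullet> a) *\<^sub>R b"
  by (simp add: oct_defs inner_prod_def algebra_simps)

lemma omul_minus_left: "(- a) \<odot> c = - (a \<odot> c)"
  using omul_scaleR_left[of "-1" a c] by simp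

lemma omul_minus_right: "c \<odot> (- a) = - (c \<odot> a)"
  using omul_scaleR_right[of c "-1" a] by simp

lemma omul_diff_left: "(a - b) \<odot> c = a \<odot> c - b \<odot> c"
  using omul_add_left[of a "- b" c] by (simp add: omul_minus_left)

lemma omul_diff_right: "c \<odot> (a - b) = c \<odot> a - c \<odot> b"
  using omul_add_right[of c a "- b"] by (simp add: omul_minus_right)

lemma omul_zero [simp]: "0 \<odot> a = 0" "a \<odot> 0 = 0"
  using omul_scaleR_left[of 0 0 a] omul_scaleR_right[of a 0 0] by simp_all

lemma oconj_minus: "oconj (- a) = - oconj a"
  using oconj_scaleR[of "-1" a] by simp

lemma oconj_diff: "oconj (a - b) = oconj a - oconj b"
  using oconj_add[of a "- b"] by (simp add: oconj_minus)

lemma oconj_zero [simp]: "oconj 0 = 0"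
  using oconj_scaleR[of 0 0] by simp

lemmas omul_bilinear = omul_add_left omul_add_right omul_diff_left omul_diff_right
  omul_minus_left omul_minus_right omul_scaleR_left omul_scaleR_right
  oconj_add oconj_diff oconj_minus oconj_scaleR

lemma inner_o1_o1 [simp]: "o1 \<bullet> o1 = 1"
  by (simp add: o1_def inner_prod_def)

lemma omul_oconj_self: "a \<odot> oconj a = (a \<bullet> a) *\<^sub>R o1"
  using omul_oconj_cancel[of o1 a] by simp

lemma inner_omul_omul_left: "(a \<odot> b) \<bullet> (a \<odot> c) = (a \<bullet> a) * (b \<bullet> c)"
  by (simp add: inner_omul_left oconj_omul_cancel)

lemma inner_omul_omul_right: "(b \<odot> a) \<bullet> (c \<odot> a) = (a \<bullet> a) * (b \<bullet> c)"
  by (simp add: inner_omul_right omul_oconj_cancel)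

text \<open>Polarization in the left factor of the composition law
  \<open>inner_omul_omul_left\<close>.\<close>

lemma inner_omul_exchange: "(a \<odot> b) \<bullet> (c \<odot> d) + (a \<odot> d) \<bullet> (c \<odot> b) = 2 * (a \<bullet> c) * (b \<bullet> d)"
proof -
  have "((a + c) \<odot> b) \<bullet> ((a + c) \<odot> d) = ((a + c) \<bullet> (a + c)) * (b \<bullet> d)"
    by (rule inner_omul_omul_left)
  then show ?thesis
    by (simp add: omul_bilinear inner_omul_omul_left inner_add inner_commute algebra_simps)
qed

lemma oconj_omul_exchange: "oconj a \<odot> (b \<odot> c) + oconj b \<odot> (a \<odot> c) = (2 * (a \<bullet> b)) *\<^sub>R c"
proof -
  have "oconj (a + b) \<odot> ((a + b) \<odot> c) = ((a + b) \<bullet> (a + b)) *\<^sub>R c"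
    by (rule oconj_omul_cancel)
  then show ?thesis
    by (simp add: omul_bilinear oconj_omul_cancel inner_add inner_commute algebra_simps
        flip: scaleR_2)
qed

text \<open>The case \<open>c = o1\<close> of \<open>oconj_omul_exchange\<close>, with conjugates
  rewritten by \<open>oconj_eq\<close>. It turns symmetrised products into real combinations of the
  factors and \<open>o1\<close>.\<close>

lemma omul_anticommutator:
  "a \<odot> b + b \<odot> a = (2 * (a \<bullet> o1)) *\<^sub>R b + (2 * (b \<bullet> o1)) *\<^sub>R a - (2 * (a \<bullet> b)) *\<^sub>R o1"
  using oconj_omul_exchange[of a b o1]
  by (simp add: oconj_eq omul_bilinear algebra_simps inner_commute)

lemma inner_omul_move: "(z \<odot> c) \<bullet> y = 2 * (c \<bullet> o1) * (z \<bullet> y) - z \<bullet> (y \<odot> c)"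
  by (simp add: inner_omul_right oconj_eq omul_bilinear inner_diff_right)

subsection \<open>The metric and its derivatives\<close>

definition hform :: "oct \<times> oct \<Rightarrow> oct \<times> oct \<Rightarrow> real" where
  "hform X Y = fst X \<bullet> fst Y - snd X \<bullet> snd Y"

text \<open>The four-linear polarization of \<open>P(A,A;X,X)\<close>, symmetric within each pair of
  arguments, so that derivatives of the metric along lines stay expressible by it.\<close>

definition pform :: "oct \<times> oct \<Rightarrow> oct \<times> oct \<Rightarrow> oct \<times> oct \<Rightarrow> oct \<times> oct \<Rightarrow> real" where
  "pform A B X Y = (fst A \<bullet> fst B) * (fst X \<bullet> fst Y) + (snd A \<bullet> snd B) * (snd X \<bullet> snd Y)
     - ((fst A \<odot> oconj (snd B) + fst B \<odot> oconj (snd A))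
        \<bullet> (fst X \<odot> oconj (snd Y) + fst Y \<odot> oconj (snd X))) / 2"

definition Dform :: "oct \<times> oct \<Rightarrow> real" where
  "Dform q = 1 + hform q q"

lemma hform_bilinear:
  "hform (X + X') Y = hform X Y + hform X' Y" "hform X (Y + Y') = hform X Y + hform X Y'"
  "hform (X - X') Y = hform X Y - hform X' Y" "hform X (Y - Y') = hform X Y - hform X Y'"
  "hform (k *\<^sub>R X) Y = k * hform X Y" "hform X (k *\<^sub>R Y) = k * hform X Y"
  by (simp_all add: hform_def inner_add inner_diff algebra_simps)

lemma hform_commute: "hform X Y = hform Y X"
  by (simp add: hform_def inner_commute)

lemma pform_linear:
  "pform (A + A') B X Y = pform A B X Y + pform A' B X Y"
  "pform A (B + B') X Y = pform A B X Y + pform A B' X Y"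
  "pform A B (X + X') Y = pform A B X Y + pform A B X' Y"
  "pform A B X (Y + Y') = pform A B X Y + pform A B X Y'"
  "pform (k *\<^sub>R A) B X Y = k * pform A B X Y"
  "pform A (k *\<^sub>R B) X Y = k * pform A B X Y"
  "pform A B (k *\<^sub>R X) Y = k * pform A B X Y"
  "pform A B X (k *\<^sub>R Y) = k * pform A B X Y"
  by (simp_all add: pform_def omul_bilinear inner_add field_simps)

lemma pform_commute:
  "pform A B X Y = pform B A X Y" "pform A B X Y = pform A B Y X" "pform A B X Y = pform X Y A B"
  by (simp_all add: pform_def inner_commute add.commute mult.commute)

lemma OP11_dom_eq: "OP11_dom = {q. Dform q > 0}"
  by (auto simp: OP11_dom_def Dform_def hform_def onorm2_eq_inner)

lemma OP11_ds2_eq: "OP11_ds2 q X = (hform X X * Dform q - pform q q X X) / (Dform q)\<^sup>2"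
proof -
  have ore: "ore (a \<odot> oconj b) = a \<bullet> b" for a b
    by (simp add: oinner_eq_inner flip: oinner_def)
  have "ore ((u \<odot> oconj v) \<odot> (\<eta> \<odot> oconj \<xi>)) = (u \<odot> oconj v) \<bullet> (\<xi> \<odot> oconj \<eta>)" for u v \<xi> \<eta>
    using ore[of "u \<odot> oconj v" "\<xi> \<odot> oconj \<eta>"] by (simp add: oconj_omul oconj_oconj)
  then show ?thesis
    by (simp add: OP11_ds2_def case_prod_beta onorm2_eq_inner hform_def pform_def Dform_def
        inner_add algebra_simps)
qed

lemma OP11_metric_eq: "OP11_metric q X Y = hform X Y / Dform q - pform q q X Y / (Dform q)\<^sup>2"
proof -
  have X: "X - Y = X + (-1) *\<^sub>R Y" by simp
  have "OP11_metric q X Y = (hform X Y * Dform q - pform q q X Y) / (Dform q)\<^sup>2"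
    unfolding OP11_metric_def OP11_ds2_eq X hform_bilinear pform_linear
    \<comment> \<open>Where \<open>Dform q\<close> vanishes, both sides are 0 by the convention for
      division by zero.\<close>
    by (cases "Dform q = 0")
      (simp_all add: hform_commute[of Y X] pform_commute(2)[of q q Y X] field_simps)
  then show ?thesis
    by (simp add: diff_divide_distrib power2_eq_square)
qed

lemma Dform_line: "Dform (q + t *\<^sub>R X) = Dform q + 2 * t * hform q X + t\<^sup>2 * hform X X"
  by (simp add: Dform_def hform_bilinear hform_commute[of X q] power2_eq_square algebra_simps)

lemma pform_line: "pform (q + t *\<^sub>R X) (q + t *\<^sub>R X) Y Z
    = pform q q Y Z + 2 * t * pform q X Y Z + t\<^sup>2 * pform X X Y Z"
  by (simp add: pform_linear pform_commute(1)[of X q] power2_eq_square algebra_simps)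

lemma dirD_OP11_metric:
  assumes "Dform q \<noteq> 0"
  shows "dirD (\<lambda>q. OP11_metric q Y Z) q X =
    - 2 * (hform q X * hform Y Z + pform q X Y Z) / (Dform q)\<^sup>2
    + 4 * hform q X * pform q q Y Z / (Dform q) ^ 3"
proof -
  have "((\<lambda>t. OP11_metric (q + t *\<^sub>R X) Y Z) has_real_derivative
     - 2 * (hform q X * hform Y Z + pform q X Y Z) / (Dform q)\<^sup>2
      + 4 * hform q X * pform q q Y Z / (Dform q) ^ 3) (at 0)"
    unfolding OP11_metric_eq Dform_line pform_line using assms
    by (auto intro!: derivative_eq_intros simp: field_simps power2_eq_square power3_eq_cube)
  then show ?thesis
    unfolding dirD_def by (rule DERIV_imp_deriv)
qed

lemma dirD2_OP11_metric:
  assumes D: "Dform q \<noteq> 0"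
  shows "dirD2 (\<lambda>q. OP11_metric q Y Z) q X W =
    - 2 * (hform X W * hform Y Z + pform X W Y Z) / (Dform q)\<^sup>2
    + 4 * (2 * hform q X * hform q W * hform Y Z + hform X W * pform q q Y Z
        + 2 * hform q X * pform q W Y Z + 2 * hform q W * pform q X Y Z) / (Dform q) ^ 3
    - 24 * hform q X * hform q W * pform q q Y Z / (Dform q) ^ 4" (is "_ = ?R")
proof -
  \<comment> \<open>The first-order formula is available only where \<open>Dform\<close> is nonzero,
    so the inner derivative is replaced on a neighbourhood of \<open>s = 0\<close>.\<close>
  have ev: "\<forall>\<^sub>F s in nhds 0. Dform (q + s *\<^sub>R X) \<noteq> 0"
  proof -
    have "isCont (\<lambda>s. Dform (q + s *\<^sub>R X)) 0"
      unfolding Dform_line by (intro continuous_intros)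
    then have "((\<lambda>s. Dform (q + s *\<^sub>R X)) \<longlongrightarrow> Dform (q + 0 *\<^sub>R X)) (nhds 0)"
      using tendsto_at_iff_tendsto_nhds[of "\<lambda>s. Dform (q + s *\<^sub>R X)" 0] by (simp add: isCont_def)
    then show ?thesis
      by (rule tendsto_imp_eventually_ne) (simp add: D)
  qed
  let ?f = "\<lambda>s. - 2 * ((hform q W + s * hform X W) * hform Y Z + (pform q W Y Z + s * pform X W Y Z))
        / (Dform q + 2 * s * hform q X + s\<^sup>2 * hform X X)\<^sup>2
    + 4 * (hform q W + s * hform X W) * (pform q q Y Z + 2 * s * pform q X Y Z + s\<^sup>2 * pform X X Y Z)
        / (Dform q + 2 * s * hform q X + s\<^sup>2 * hform X X) ^ 3"
  have "\<forall>\<^sub>F s in nhds 0. deriv (\<lambda>t. OP11_metric (q + s *\<^sub>R X + t *\<^sub>R W) Y Z) 0 = ?f s"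
    using ev
  proof eventually_elim
    case (elim s)
    show ?case
      using dirD_OP11_metric[OF elim, of Y Z W]
      unfolding dirD_def Dform_line pform_line by (simp add: hform_bilinear pform_linear)
  qed
  then have "dirD2 (\<lambda>q. OP11_metric q Y Z) q X W = deriv ?f 0"
    unfolding dirD2_def by (rule deriv_cong_ev) simp
  also have "(?f has_real_derivative ?R) (at 0)"
    using D by (auto intro!: derivative_eq_intros) (simp add: field_simps power_numeral_reduce)
  then have "deriv ?f 0 = ?R"
    by (rule DERIV_imp_deriv)
  finally show ?thesis .
qed

subsection \<open>Points with real coordinates\<close>

definition real_pt :: "real \<Rightarrow> real \<Rightarrow> oct \<times> oct" where
  "real_pt r s = (r *\<^sub>R o1, s *\<^sub>R o1)"

text \<open>The octonion-valued Hermitian product of a real point with \<open>X\<close>: its real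
  part is \<open>hform\<close> with the point, and its inner products give \<open>pform\<close> at
  the point.\<close>

definition real_pair :: "real \<Rightarrow> real \<Rightarrow> oct \<times> oct \<Rightarrow> oct" where
  "real_pair r s X = r *\<^sub>R fst X - s *\<^sub>R snd X"

definition rmul :: "oct \<times> oct \<Rightarrow> oct \<Rightarrow> oct \<times> oct" where
  "rmul X c = (fst X \<odot> c, snd X \<odot> c)"

text \<open>The octonionic substitute for the squared determinant \<open>|V1 X2 - V2 X1|^2\<close>;
  \<open>pform_diag\<close> is then the Lagrange identity in signature (1,1).\<close>

definition wform :: "oct \<times> oct \<Rightarrow> oct \<times> oct \<Rightarrow> real" where
  "wform V X = (fst V \<bullet> fst V) * (snd X \<bullet> snd X) + (snd V \<bullet> snd V) * (fst X \<bullet> fst X)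
     - 2 * ((fst V \<odot> oconj (snd V)) \<bullet> (fst X \<odot> oconj (snd X)))"

lemma pform_diag: "pform V V X X = hform V V * hform X X + wform V X"
  by (simp add: pform_def hform_def wform_def inner_add algebra_simps)

text \<open>The exchange law trades the cross term \<open><V1 X2*, X1 V2*>\<close> for the term
  \<open><V1 V2*, X1 X2*>\<close> of \<open>wform\<close>.\<close>

lemma pform_mixed: "2 * pform V X V X = 2 * (hform V X)\<^sup>2 - wform V X"
  using inner_omul_exchange[of "fst V" "oconj (snd X)" "fst X" "oconj (snd V)"]
  by (simp add: pform_def hform_def wform_def inner_add inner_commute power2_eq_square inner_oconj
      inner_omul_omul_right inner_omul_omul_left field_simps)

lemma hform_real_pt: "hform (real_pt r s) X = real_pair r s X \<bullet> o1"
  by (simp add: hform_def real_pt_def real_pair_def inner_diff inner_commute)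

lemma Dform_real_pt: "Dform (real_pt r s) = 1 + r\<^sup>2 - s\<^sup>2"
  by (simp add: Dform_def hform_def real_pt_def power2_eq_square)

lemma pform_real_pt: "pform (real_pt r s) (real_pt r s) X Y = real_pair r s X \<bullet> real_pair r s Y"
  by (simp add: pform_def real_pt_def real_pair_def omul_bilinear inner_add inner_diff
      inner_omul_right[symmetric] inner_omul_right[of _ _ o1] oconj_oconj inner_commute algebra_simps)

lemma hform_rmul_move:
  "hform (rmul Z c) Y = 2 * (c \<bullet> o1) * hform Z Y - hform (rmul Y c) Z"
  using inner_omul_move[of "fst Z" c "fst Y"] inner_omul_move[of "snd Z" c "snd Y"]
  by (simp add: hform_def rmul_def inner_commute algebra_simps)

text \<open>With one argument real, every product in \<open>pform\<close> has at most two octonionic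
  factors, and the adjoint laws gather them into right multiplication by
  \<open>real_pair r s Y\<close>.\<close>

lemma pform_real_pt1_diag: "pform (real_pt r s) X Y Y = hform (rmul X (real_pair r s Y)) Y"
proof -
  have 1: "(fst X \<odot> fst Y) \<bullet> fst Y = (fst Y \<bullet> fst Y) * (fst X \<bullet> o1)"
    "(snd X \<odot> snd Y) \<bullet> snd Y = (snd Y \<bullet> snd Y) * (snd X \<bullet> o1)"
    by (simp_all add: inner_omul_right omul_oconj_self)
  have 2: "(fst X \<odot> snd Y) \<bullet> fst Y = fst X \<bullet> (fst Y \<odot> oconj (snd Y))"
    by (simp add: inner_omul_right)
  have 3: "(snd X \<odot> fst Y) \<bullet> snd Y = oconj (snd X) \<bullet> (fst Y \<odot> oconj (snd Y))"
    using inner_oconj[of "snd X" "snd Y \<odot> oconj (fst Y)"]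
    by (simp add: inner_omul_right oconj_omul oconj_oconj)
  show ?thesis
    by (simp add: pform_def real_pt_def real_pair_def hform_def rmul_def omul_bilinear inner_add inner_diff
        1 2 3 inner_commute[of o1] algebra_simps)
qed

lemma real_pair_linear:
  "real_pair r s (X + Y) = real_pair r s X + real_pair r s Y"
  "real_pair r s (X - Y) = real_pair r s X - real_pair r s Y"
  "real_pair r s (k *\<^sub>R X) = k *\<^sub>R real_pair r s X"
  by (simp_all add: real_pair_def algebra_simps)

lemma real_pair_rmul: "real_pair r s (rmul X c) = real_pair r s X \<odot> c"
  by (simp add: real_pair_def rmul_def omul_bilinear)

lemma rmul_bilinear:
  "rmul (X + Y) c = rmul X c + rmul Y c" "rmul X (c + d) = rmul X c + rmul X d"
  "rmul (X - Y) c = rmul X c - rmul Y c" "rmul X (c - d) = rmul X c - rmul X d"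
  "rmul (k *\<^sub>R X) c = k *\<^sub>R rmul X c" "rmul X (k *\<^sub>R c) = k *\<^sub>R rmul X c"
  by (simp_all add: rmul_def omul_bilinear)

lemma rmul_o1 [simp]: "rmul X o1 = X"
  by (simp add: rmul_def)

lemma pform_real_pt1:
  "2 * pform (real_pt r s) X Y Z = hform (rmul X (real_pair r s Y)) Z + hform (rmul X (real_pair r s Z)) Y"
  using pform_real_pt1_diag[of r s X "Y + Z"]
  by (simp add: pform_linear hform_bilinear real_pair_linear rmul_bilinear pform_real_pt1_diag pform_commute(2)[of _ _ Z Y])

lemma hform_rmul_exchange:
  "hform (rmul X c) (rmul Y d) + hform (rmul X d) (rmul Y c) = 2 * hform X Y * (c \<bullet> d)"
  using inner_omul_exchange[of "fst X" c "fst Y" d] inner_omul_exchange[of "snd X" c "snd Y" d]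
  by (simp add: hform_def rmul_def algebra_simps)

lemma hform_rmul_rmul: "hform (rmul X c) (rmul Y c) = hform X Y * (c \<bullet> c)"
  using hform_rmul_exchange[of X c Y c] by simp

section \<open>The Levi-Civita connection at real points\<close>

definition real_christ :: "real \<Rightarrow> real \<Rightarrow> oct \<times> oct \<Rightarrow> oct \<times> oct \<Rightarrow> oct \<times> oct" where
  "real_christ r s X Y = (- 1 / Dform (real_pt r s)) *\<^sub>R (rmul X (real_pair r s Y) + rmul Y (real_pair r s X))"

lemma koszul_real_pt:
  assumes D: "Dform (real_pt r s) \<noteq> 0"
  defines "p \<equiv> real_pt r s"
  shows "OP11_metric p (real_christ r s X Y) Z =
     (dirD (\<lambda>q. OP11_metric q Y Z) p X + dirD (\<lambda>q. OP11_metric q X Z) p Y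
       - dirD (\<lambda>q. OP11_metric q X Y) p Z) / 2"
proof -
  define d where "d = Dform p"
  have d: "d \<noteq> 0" using D by (simp add: d_def p_def)
  let ?c = "real_pair r s"
  \<comment> \<open>The Koszul combination of the polarized form: moving right multiplications
    across \<open>hform\<close> leaves only the products that occur in \<open>real_christ\<close>,
    plus scalar terms.\<close>
  have 1: "pform p X Y Z + pform p Y X Z - pform p Z X Y =
     hform (rmul X (?c Y)) Z + hform (rmul Y (?c X)) Z
     + (?c Z \<bullet> o1) * hform X Y - (?c X \<bullet> o1) * hform Y Z - (?c Y \<bullet> o1) * hform X Z"
    using pform_real_pt1[of r s X Y Z] pform_real_pt1[of r s Y X Z] pform_real_pt1[of r s Z X Y]
      hform_rmul_move[of Z "?c X" Y] hform_rmul_move[of Z "?c Y" X] hform_rmul_move[of X "?c Z" Y]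
      hform_commute[of Z Y] hform_commute[of Z X]
    unfolding p_def by (simp add: algebra_simps)
  then have pZ: "pform p Z X Y = pform p X Y Z + pform p Y X Z
     - (hform (rmul X (?c Y)) Z + hform (rmul Y (?c X)) Z)
     - (?c Z \<bullet> o1) * hform X Y + (?c X \<bullet> o1) * hform Y Z + (?c Y \<bullet> o1) * hform X Z"
    by simp
  have 2: "?c X \<odot> ?c Y + ?c Y \<odot> ?c X = (2 * (?c X \<bullet> o1)) *\<^sub>R ?c Y + (2 * (?c Y \<bullet> o1)) *\<^sub>R ?c X
     - (2 * (?c X \<bullet> ?c Y)) *\<^sub>R o1"
    by (rule omul_anticommutator)
  \<comment> \<open>Since \<open>real_pair\<close> commutes with right multiplication, the
    \<open>pform\<close> part of the metric sees only the anticommutator of \<open>?c X\<close> and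
    \<open>?c Y\<close>, which fact 2 linearises.\<close>
  have 3: "OP11_metric p (real_christ r s X Y) Z =
     ((?c X \<odot> ?c Y + ?c Y \<odot> ?c X) \<bullet> ?c Z) / d ^ 3
     - (hform (rmul X (?c Y)) Z + hform (rmul Y (?c X)) Z) / d\<^sup>2"
  proof -
    define k where "k = - 1 / d"
    have "OP11_metric p (real_christ r s X Y) Z =
      k * (hform (rmul X (?c Y)) Z + hform (rmul Y (?c X)) Z) / d
      - k * ((?c X \<odot> ?c Y + ?c Y \<odot> ?c X) \<bullet> ?c Z) / d\<^sup>2"
      unfolding OP11_metric_eq real_christ_def p_def[symmetric] d_def[symmetric] k_def[symmetric]
      unfolding p_def
      by (simp add: pform_real_pt real_pair_linear real_pair_rmul hform_bilinear inner_add)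
    then show ?thesis
      by (simp add: k_def power2_eq_square power3_eq_cube mult.assoc)
  qed
  show ?thesis
    unfolding 3 2 unfolding p_def dirD_OP11_metric[OF D] hform_real_pt pform_real_pt
    unfolding p_def[symmetric] d_def[symmetric] pZ
    using d by (simp add: field_simps power_numeral_reduce inner_add inner_diff inner_commute)
qed

lemma real_christ_metric:
  assumes D: "Dform (real_pt r s) \<noteq> 0"
  defines "d \<equiv> Dform (real_pt r s)" and "c \<equiv> real_pair r s"
  shows "OP11_metric (real_pt r s) (real_christ r s X Y) (real_christ r s Z W) =
    hform (rmul X (c Y) + rmul Y (c X)) (rmul Z (c W) + rmul W (c Z)) / d ^ 3
    - (c X \<odot> c Y + c Y \<odot> c X) \<bullet> (c Z \<odot> c W + c W \<odot> c Z) / d ^ 4"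
proof -
  have scale: "OP11_metric (real_pt r s) (k *\<^sub>R A) (k *\<^sub>R B) = k\<^sup>2 * (hform A B / d - (c A \<bullet> c B) / d\<^sup>2)" for k A B
    unfolding OP11_metric_eq pform_real_pt d_def c_def
    by (simp add: real_pair_linear hform_bilinear power2_eq_square algebra_simps)
  show ?thesis
    using D unfolding real_christ_def scale d_def[symmetric]
    by (simp add: real_pair_linear real_pair_rmul c_def power_numeral_reduce field_simps)
qed

text \<open>Passing to conjugates of the second factors turns the products into scalars and the
  single quartic invariant occurring in \<^const>\<open>wform\<close>.\<close>
lemma hform_rmul_real_pair:
  fixes r s V X
  defines "c \<equiv> real_pair r s"
  shows "2 * hform (rmul V (c V)) (rmul X (c X)) =
    hform V V * (c X \<bullet> c X) + hform X X * (c V \<bullet> c V) + (r\<^sup>2 - s\<^sup>2) * wform V X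
    + 4 * (c V \<bullet> o1) * hform (rmul X (c X)) V + 4 * (c X \<bullet> o1) * hform (rmul V (c V)) X
    - 8 * (c V \<bullet> o1) * (c X \<bullet> o1) * hform V X"
proof -
  have sw: "(snd V \<odot> oconj (fst V)) \<bullet> (snd X \<odot> oconj (fst X))
      = (fst V \<odot> oconj (snd V)) \<bullet> (fst X \<odot> oconj (snd X))"
    using inner_oconj[of "snd V \<odot> oconj (fst V)" "snd X \<odot> oconj (fst X)"]
    by (simp add: oconj_omul oconj_oconj)
  have 1: "2 * hform (rmul V (oconj (c V))) (rmul X (oconj (c X))) =
      hform V V * (c X \<bullet> c X) + hform X X * (c V \<bullet> c V) + (r\<^sup>2 - s\<^sup>2) * wform V X"
    unfolding hform_def rmul_def c_def real_pair_def fst_conv snd_conv omul_bilinear omul_oconj_self wform_def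
    by (simp add: inner_diff inner_omul_oconj_o1 sw inner_commute power2_eq_square algebra_simps)
  have oc: "rmul X (oconj a) = (2 * (a \<bullet> o1)) *\<^sub>R X - rmul X a" for X a
    by (simp add: oconj_eq rmul_bilinear)
  show ?thesis
    using 1 hform_commute[of V "rmul X (c X)"] unfolding oc hform_bilinear
    by (simp add: algebra_simps)
qed

text \<open>The left side is \<open>curv4\<close> on \<open>(V, X, V, X)\<close> with the explicit
  Christoffel symbols inserted. Each octonionic expression reduces to a few real scalars, leaving an
  identity of rational functions.\<close>

lemma curv_real_pt_diag:
  assumes D: "Dform (real_pt r s) \<noteq> 0"
  defines "p \<equiv> real_pt r s"
  defines "g \<equiv> OP11_metric"
  shows "(dirD2 (\<lambda>q. g q X V) p V X + dirD2 (\<lambda>q. g q V X) p X V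
      - dirD2 (\<lambda>q. g q V V) p X X - dirD2 (\<lambda>q. g q X X) p V V) / 2
     + g p (real_christ r s X V) (real_christ r s V X) - g p (real_christ r s V V) (real_christ r s X X)
   = 4 * g p V V * g p X X - 4 * (g p V X)\<^sup>2 + 3 * wform V X / (Dform p) ^ 3"
proof -
  define d where "d = Dform p"
  have d: "d \<noteq> 0" using D by (simp add: d_def p_def)
  let ?c = "real_pair r s"
  define A B C where "A = hform V V" and "B = hform X X" and "C = hform V X"
  define \<rho> \<sigma> where "\<rho> = ?c V \<bullet> o1" and "\<sigma> = ?c X \<bullet> o1"
  define n n' m where "n = ?c V \<bullet> ?c V" and "n' = ?c X \<bullet> ?c X" and "m = ?c V \<bullet> ?c X"
  define a b where "a = hform (rmul V (?c V)) X" and "b = hform (rmul X (?c X)) V"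
  define E w where "E = hform (rmul V (?c V)) (rmul X (?c X))" and "w = wform V X"
  note abbr = A_def B_def C_def \<rho>_def \<sigma>_def n_def n'_def m_def a_def b_def E_def w_def
  have C': "hform X V = C" and m': "?c X \<bullet> ?c V = m"
    by (simp_all add: abbr hform_commute inner_commute)
  have P1: "pform p V X V = (a + \<sigma> * A) / 2" "pform p V V X = (a + \<sigma> * A) / 2"
    using pform_real_pt1[of r s V V X] hform_rmul_move[of V "?c X" V] pform_commute(2)[of p V V X]
    by (simp_all add: abbr p_def)
  have P2: "pform p X X V = (b + \<rho> * B) / 2" "pform p X V X = (b + \<rho> * B) / 2"
    using pform_real_pt1[of r s X X V] hform_rmul_move[of X "?c V" X] pform_commute(2)[of p X V X]
    by (simp_all add: abbr p_def)
  have P3: "pform p X V V = 2 * \<rho> * C - a"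
    using pform_real_pt1_diag[of r s X V] hform_rmul_move[of X "?c V" V]
    by (simp add: abbr p_def hform_commute[of X V])
  have P4: "pform p V X X = 2 * \<sigma> * C - b"
    using pform_real_pt1_diag[of r s V X] hform_rmul_move[of V "?c X" X]
    by (simp add: abbr p_def)
  have P5: "pform V X V X = C\<^sup>2 - w / 2" "pform V X X V = C\<^sup>2 - w / 2"
      "pform X V V X = C\<^sup>2 - w / 2" "pform X V X V = C\<^sup>2 - w / 2"
    using pform_mixed[of V X] pform_commute(1)[of X V] pform_commute(2)[of V X X V]
    by (simp_all add: abbr)
  have P6: "pform V V X X = A * B + w" "pform X X V V = A * B + w"
    using pform_diag[of V X] pform_commute(3)[of X X V V] by (simp_all add: abbr)
  have H1: "hform (rmul X (?c V) + rmul V (?c X)) (rmul V (?c X) + rmul X (?c V))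
      = A * n' + B * n + 2 * (2 * C * m - E)"
    using hform_rmul_rmul[of V "?c X" V] hform_rmul_rmul[of X "?c V" X]
      hform_rmul_exchange[of V "?c V" X "?c X"] hform_commute[of "rmul X (?c V)" "rmul V (?c X)"]
    by (simp add: hform_bilinear abbr algebra_simps)
  have H2: "hform (rmul V (?c V) + rmul V (?c V)) (rmul X (?c X) + rmul X (?c X)) = 4 * E"
    by (simp add: hform_bilinear abbr)
  have K1: "(?c X \<odot> ?c V + ?c V \<odot> ?c X) \<bullet> (?c V \<odot> ?c X + ?c X \<odot> ?c V)
      = 4 * \<rho>\<^sup>2 * n' + 4 * \<sigma>\<^sup>2 * n + 4 * m\<^sup>2 - 8 * m * \<rho> * \<sigma>"
    unfolding omul_anticommutator
    by (simp add: inner_add inner_diff abbr inner_commute power2_eq_square algebra_simps)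
  have K2: "(?c V \<odot> ?c V + ?c V \<odot> ?c V) \<bullet> (?c X \<odot> ?c X + ?c X \<odot> ?c X)
      = 4 * (4 * \<rho> * \<sigma> * m - 2 * \<rho>\<^sup>2 * n' - 2 * \<sigma>\<^sup>2 * n + n * n')"
    unfolding omul_anticommutator
    by (simp add: inner_add inner_diff abbr inner_commute power2_eq_square algebra_simps)
  \<comment> \<open>The relation that ties the quartic scalar \<open>E\<close> to the others; the
    factor \<open>d - 1\<close> is \<open>r^2 - s^2\<close>.\<close>
  have E: "E = (A * n' + B * n + (d - 1) * w) / 2 + 2 * \<rho> * b + 2 * \<sigma> * a - 4 * \<rho> * \<sigma> * C"
    using hform_rmul_real_pair[of V r s X] by (simp add: abbr d_def p_def Dform_real_pt field_simps)
  show ?thesis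
    unfolding g_def p_def dirD2_OP11_metric[OF D] real_christ_metric[OF D] H1 H2 K1 K2
    unfolding OP11_metric_eq hform_real_pt pform_real_pt
    unfolding p_def[symmetric] d_def[symmetric] P1 P2 P3 P4 P5 P6 C' m' abbr[symmetric] E
    using d by (simp add: field_simps power_numeral_reduce)
qed

subsection \<open>The curvature at real points\<close>

lemma hform_eqI:
  assumes "\<And>Z. hform X Z = hform Y Z"
  shows "X = Y"
proof -
  define U where "U = X - Y"
  \<comment> \<open>Flipping the sign of the second component makes \<open>hform\<close>
    Euclidean.\<close>
  have "hform U (fst U, - snd U) = 0"
    using assms by (simp add: U_def hform_bilinear)
  then have "fst U \<bullet> fst U + snd U \<bullet> snd U = 0"
    by (simp add: hform_def)
  then have "fst U \<bullet> fst U = 0 \<and> snd U \<bullet> snd U = 0"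
    by (metis add_nonneg_eq_0_iff inner_ge_zero)
  then show ?thesis
    by (simp add: U_def prod_eq_iff)
qed

text \<open>At a real point the metric is a real 2x2 Gram matrix acting on the components, with
  entries \<open>1/d - r^2/d^2\<close>, \<open>r s/d^2\<close> and \<open>-(1/d + s^2/d^2)\<close>.
  This is its triangular factorization relative to \<open>hform\<close>; the coefficients are real,
  so no products are disturbed.\<close>

definition real_frame :: "real \<Rightarrow> real \<Rightarrow> oct \<times> oct \<Rightarrow> oct \<times> oct" where
  "real_frame r s X = (let d = Dform (real_pt r s); n = sqrt (1 + r\<^sup>2) in
     ((1 / (sqrt d * n)) *\<^sub>R fst X, (n / d) *\<^sub>R snd X - (r * s / (d * n)) *\<^sub>R fst X))"

text \<open>As for a squared determinant, a real matrix scales \<open>wform\<close> by the square of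
  its own determinant, here \<open>a * b\<close>.\<close>

lemma wform_triangular:
  "wform (a *\<^sub>R fst V, b *\<^sub>R snd V - c *\<^sub>R fst V) (a *\<^sub>R fst X, b *\<^sub>R snd X - c *\<^sub>R fst X)
    = (a * b)\<^sup>2 * wform V X"
  by (simp add: wform_def omul_bilinear omul_oconj_self inner_diff inner_omul_oconj_o1 inner_commute
      power2_eq_square algebra_simps)

lemma real_frame_props:
  assumes D: "Dform (real_pt r s) > 0"
  shows "linear (real_frame r s)"
    and hform_real_frame: "hform (real_frame r s X) (real_frame r s Y) = OP11_metric (real_pt r s) X Y"
    and wform_real_frame: "wform (real_frame r s X) (real_frame r s Y) = wform X Y / Dform (real_pt r s) ^ 3"
proof -
  define d where "d = Dform (real_pt r s)"
  define n where "n = sqrt (1 + r\<^sup>2)"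
  have d: "d > 0" using D by (simp add: d_def)
  have dd: "d = 1 + r\<^sup>2 - s\<^sup>2" by (simp add: d_def Dform_real_pt)
  have n0: "n > 0" unfolding n_def by (simp add: add_pos_nonneg)
  have n2: "n\<^sup>2 = 1 + r\<^sup>2" unfolding n_def by (simp add: add_nonneg_nonneg)
  define a b c where "a = 1 / (sqrt d * n)" and "b = n / d" and "c = r * s / (d * n)"
  have F: "real_frame r s X = (a *\<^sub>R fst X, b *\<^sub>R snd X - c *\<^sub>R fst X)" for X
    by (simp add: real_frame_def Let_def a_def b_def c_def d_def n_def)
  show "linear (real_frame r s)"
    by (rule linearI) (simp_all add: F algebra_simps)
  have "c\<^sup>2 = r\<^sup>2 * s\<^sup>2 / (d\<^sup>2 * n\<^sup>2)" "a\<^sup>2 = 1 / (d * n\<^sup>2)"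
    using d by (simp_all add: a_def c_def power_divide power_mult_distrib)
  then have "a\<^sup>2 - c\<^sup>2 = (d - r\<^sup>2 * s\<^sup>2) / (d\<^sup>2 * n\<^sup>2)"
    using d n0 by (simp add: field_simps power2_eq_square)
  also have "d - r\<^sup>2 * s\<^sup>2 = (d - r\<^sup>2) * n\<^sup>2"
    unfolding n2 dd by (simp add: algebra_simps power2_eq_square)
  also have "(d - r\<^sup>2) * n\<^sup>2 / (d\<^sup>2 * n\<^sup>2) = 1 / d - r\<^sup>2 / d\<^sup>2"
    using d n0 by (simp add: diff_divide_distrib power2_eq_square)
  finally have 1: "a\<^sup>2 - c\<^sup>2 = 1 / d - r\<^sup>2 / d\<^sup>2" .
  have 2: "b * c = r * s / d\<^sup>2"
    using n0 d by (simp add: b_def c_def power2_eq_square)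
  have "b\<^sup>2 = n\<^sup>2 / d\<^sup>2"
    by (simp add: b_def power_divide)
  also have "\<dots> = 1 / d + s\<^sup>2 / d\<^sup>2"
    using d unfolding n2 by (simp add: field_simps power2_eq_square) (simp add: dd power2_eq_square algebra_simps)
  finally have 3: "b\<^sup>2 = 1 / d + s\<^sup>2 / d\<^sup>2" .
  have "hform (real_frame r s X) (real_frame r s Y) = (a\<^sup>2 - c\<^sup>2) * (fst X \<bullet> fst Y) - b\<^sup>2 * (snd X \<bullet> snd Y)
      + (b * c) * (fst X \<bullet> snd Y + snd X \<bullet> fst Y)"
    by (simp add: F hform_def inner_diff power2_eq_square algebra_simps)
  also have "\<dots> = OP11_metric (real_pt r s) X Y"
    unfolding 1 2 3 OP11_metric_eq pform_real_pt d_def[symmetric]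
    by (simp add: hform_def real_pair_def inner_diff power2_eq_square add_divide_distrib diff_divide_distrib algebra_simps)
  finally show "hform (real_frame r s X) (real_frame r s Y) = OP11_metric (real_pt r s) X Y" .
  have "(a * b)\<^sup>2 = 1 / d ^ 3"
    using n0 d by (simp add: a_def b_def power_divide power_mult_distrib power_numeral_reduce)
  then show "wform (real_frame r s X) (real_frame r s Y) = wform X Y / Dform (real_pt r s) ^ 3"
    unfolding F wform_triangular d_def by simp
qed

lemma linear_bijI:
  fixes F :: "'a::euclidean_space \<Rightarrow> 'a"
  assumes "linear F" and "\<And>X. F X = 0 \<Longrightarrow> X = 0"
  shows "bij F"
  using assms linear_injective_0[of F] linear_injective_imp_surjective[of F] by (auto simp: bij_def)

lemma bij_real_frame:
  assumes D: "Dform (real_pt r s) > 0"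
  shows "bij (real_frame r s)"
proof (rule linear_bijI[OF real_frame_props(1)[OF D]])
  fix X assume "real_frame r s X = 0"
  moreover have "sqrt (1 + r\<^sup>2) \<noteq> 0"
    by (simp add: add_nonneg_eq_0_iff)
  ultimately show "X = 0"
    using D by (auto simp: real_frame_def Let_def prod_eq_iff)
qed

definition model_curv :: "oct \<times> oct \<Rightarrow> oct \<times> oct \<Rightarrow> oct \<times> oct \<Rightarrow> real" where
  "model_curv V X W = hform V V * hform X W - 4 * hform V X * hform V W + 3 * pform V V X W"

text \<open>Curvature is recorded with equal first and third arguments, which is what determines the
  Jacobi operators.\<close>

definition model_frame :: "oct \<times> oct \<Rightarrow> (oct \<times> oct \<Rightarrow> oct \<times> oct) \<Rightarrow> bool" where
  "model_frame p F \<longleftrightarrow> linear F \<and> bij F \<and> (\<forall>X Y. OP11_metric p X Y = hform (F X) (F Y)) \<and>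
     (\<forall>V X W. curv4 OP11_metric p V X V W = model_curv (F V) (F X) (F W))"

lemma OP11_metric_eqI:
  assumes "bij F" "\<And>X Y. OP11_metric p X Y = hform (F X) (F Y)"
    and "\<And>Z. OP11_metric p X Z = OP11_metric p Y Z"
  shows "X = Y"
proof -
  have "hform (F X) Z = hform (F Y) Z" for Z
    using assms(2)[of X "inv F Z"] assms(2)[of Y "inv F Z"] assms(3)[of "inv F Z"] assms(1)
    by (simp add: bij_is_surj surj_f_inv_f)
  then have "F X = F Y" by (rule hform_eqI)
  then show ?thesis using assms(1) by (simp add: bij_is_inj inj_eq)
qed

lemma symmetric_bilinear_eqI:
  fixes B T :: "'a::ab_group_add \<Rightarrow> 'a \<Rightarrow> real"
  assumes "\<And>x y. B x y = B y x" "\<And>x y z. B (x + y) z = B x z + B y z"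
    and "\<And>x y. T x y = T y x" "\<And>x y z. T (x + y) z = T x z + T y z"
    and "\<And>x. B x x = T x x"
  shows "B x y = T x y"
proof -
  have "B (x + y) (x + y) = B x x + 2 * B x y + B y y" 
    using assms(1)[of x "x + y"] assms(1)[of y "x + y"] assms(1)[of y x] by (simp add: assms(2))
  moreover have "T (x + y) (x + y) = T x x + 2 * T x y + T y y"
    using assms(3)[of x "x + y"] assms(3)[of y "x + y"] assms(3)[of y x] by (simp add: assms(4))
  ultimately show ?thesis
    using assms(5)[of "x + y"] assms(5)[of x] assms(5)[of y] by simp
qed

text \<open>Justifies the definite description in \<open>christ\<close>: the explicit symbols are a
  solution, and nondegeneracy, seen through the frame, gives uniqueness.\<close>

lemma ex1_christ_real_pt:
  assumes D: "Dform (real_pt r s) > 0"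
  defines "p \<equiv> real_pt r s" and "g \<equiv> OP11_metric"
  shows "\<exists>!w. \<forall>Z. g p w Z =
     (dirD (\<lambda>q. g q Y Z) p X + dirD (\<lambda>q. g q X Z) p Y - dirD (\<lambda>q. g q X Y) p Z) / 2"
proof -
  let ?K = "\<lambda>Z. (dirD (\<lambda>q. g q Y Z) p X + dirD (\<lambda>q. g q X Z) p Y - dirD (\<lambda>q. g q X Y) p Z) / 2"
  have K: "g p (real_christ r s X Y) Z = ?K Z" for Z
    unfolding g_def p_def using D by (intro koszul_real_pt) simp
  have "w = real_christ r s X Y" if w: "\<forall>Z. g p w Z = ?K Z" for w
  proof (rule OP11_metric_eqI[OF bij_real_frame[OF D] hform_real_frame[OF D, symmetric]])
    show "OP11_metric (real_pt r s) w Z = OP11_metric (real_pt r s) (real_christ r s X Y) Z" for Z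
      using w K[of Z] by (simp only: g_def p_def)
  qed
  then show ?thesis
    using K by blast
qed

lemma christ_real_pt:
  assumes D: "Dform (real_pt r s) > 0"
  shows "christ OP11_metric (real_pt r s) X Y = real_christ r s X Y"
  unfolding christ_def
  using koszul_real_pt[of r s X Y] D ex1_christ_real_pt[OF D, of Y X]
  by (intro the1_equality) auto

lemma model_frame_real_pt:
  assumes D: "Dform (real_pt r s) > 0"
  shows "model_frame (real_pt r s) (real_frame r s)"
proof -
  let ?p = "real_pt r s" and ?g = OP11_metric and ?F = "real_frame r s"
  have D': "Dform ?p \<noteq> 0" using D by simp
  note lin = real_frame_props(1)[OF D]
  have "curv4 ?g ?p V X V W = model_curv (?F V) (?F X) (?F W)" for V X W
  \<comment> \<open>Both sides are symmetric and additive in \<open>X\<close> and \<open>W\<close>,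
    so the diagonal computation \<open>curv_real_pt_diag\<close> suffices.\<close>
  proof (rule symmetric_bilinear_eqI[of "\<lambda>X W. curv4 ?g ?p V X V W" "\<lambda>X W. model_curv (?F V) (?F X) (?F W)"])
    have G: "curv4 ?g ?p V X V W = (dirD2 (\<lambda>q. ?g q X V) ?p V W + dirD2 (\<lambda>q. ?g q V W) ?p X V
      - dirD2 (\<lambda>q. ?g q V V) ?p X W - dirD2 (\<lambda>q. ?g q X W) ?p V V) / 2
     + ?g ?p (real_christ r s X V) (real_christ r s V W) - ?g ?p (real_christ r s V V) (real_christ r s X W)" for X W
      by (simp add: curv4_def christ_real_pt[OF D])
    have Gc: "real_christ r s X Y = real_christ r s Y X" for X Y by (simp add: real_christ_def add.commute)
    have Ga: "real_christ r s (X + Y) Z = real_christ r s X Z + real_christ r s Y Z" for X Y Z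
      by (simp add: real_christ_def real_pair_linear rmul_bilinear algebra_simps)
    show "curv4 ?g ?p V X V W = curv4 ?g ?p V W V X" for X W
      unfolding G dirD2_OP11_metric[OF D'] unfolding OP11_metric_eq Gc[of W V] Gc[of W X] Gc[of X V]
        hform_commute[of "real_christ r s V W"] pform_commute(2)[of _ _ "real_christ r s V W"]
        hform_commute[of W] hform_commute[of X V]
      by (simp add: pform_commute(2)[of _ _ X V] pform_commute(2)[of _ _ W V] pform_commute(2)[of _ _ W X]
         pform_commute(1)[of X V] pform_commute(1)[of W V] pform_commute(1)[of W X]
         algebra_simps)
    show "curv4 ?g ?p V (X + Y) V W = curv4 ?g ?p V X V W + curv4 ?g ?p V Y V W" for X Y W
      unfolding G dirD2_OP11_metric[OF D'] unfolding OP11_metric_eq Ga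
      by (simp add: hform_bilinear pform_linear add_divide_distrib diff_divide_distrib algebra_simps)
    show "model_curv (?F V) (?F X) (?F W) = model_curv (?F V) (?F W) (?F X)" for X W
      by (simp add: model_curv_def hform_commute[of "?F W"] pform_commute(2)[of _ _ "?F W"])
    show "model_curv (?F V) (?F (X + Y)) (?F W) = model_curv (?F V) (?F X) (?F W) + model_curv (?F V) (?F Y) (?F W)"
      for X Y W
      using lin by (simp add: linear_add model_curv_def hform_bilinear pform_linear algebra_simps)
    show "curv4 ?g ?p V X V X = model_curv (?F V) (?F X) (?F X)" for X
      unfolding G curv_real_pt_diag[OF D'] model_curv_def pform_diag hform_real_frame[OF D] wform_real_frame[OF D]
      by (simp add: power2_eq_square)
  qed
  then show ?thesis
    using lin bij_real_frame[OF D] hform_real_frame[OF D] by (simp add: model_frame_def)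
qed

subsection \<open>Linear isometries and reduction to real points\<close>

text \<open>Linear maps carry lines to lines and constant fields to constant fields, so coordinate
  derivatives transport without correction terms.\<close>

lemma dirD_linear:
  assumes "linear A" and "\<And>q. f (A q) = h q"
  shows "dirD f (A p) (A X) = dirD h p X"
proof -
  have "A p + t *\<^sub>R A X = A (p + t *\<^sub>R X)" for t
    using assms(1) by (simp add: linear_add linear_scale)
  then show ?thesis by (simp add: dirD_def assms(2))
qed

lemma dirD2_linear:
  assumes "linear A" and "\<And>q. f (A q) = h q"
  shows "dirD2 f (A p) (A X) (A Y) = dirD2 h p X Y"
proof -
  have "A p + s *\<^sub>R A X + t *\<^sub>R A Y = A (p + s *\<^sub>R X + t *\<^sub>R Y)" for s t
    using assms(1) by (simp add: linear_add linear_scale)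
  then show ?thesis by (simp add: dirD2_def assms(2))
qed

text \<open>Unique solvability is assumed at the image point \<open>A p\<close>, which will be the
  real point; bijectivity of \<open>A\<close> pulls it back to \<open>p\<close>.\<close>

lemma christ_linear_isometry:
  fixes g :: "'a::real_vector \<Rightarrow> 'a \<Rightarrow> 'a \<Rightarrow> real"
  assumes lin: "linear A" and bij: "bij A" and iso: "\<And>q X Y. g (A q) (A X) (A Y) = g q X Y"
    and ex1: "\<exists>!w. \<forall>Z. g (A p) w Z = (dirD (\<lambda>q. g q (A Y) Z) (A p) (A X)
      + dirD (\<lambda>q. g q (A X) Z) (A p) (A Y) - dirD (\<lambda>q. g q (A X) (A Y)) (A p) Z) / 2"
  shows "christ g (A p) (A X) (A Y) = A (christ g p X Y)"
proof -
  let ?K = "\<lambda>Z. (dirD (\<lambda>q. g q Y Z) p X + dirD (\<lambda>q. g q X Z) p Y - dirD (\<lambda>q. g q X Y) p Z) / 2"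
  let ?L = "\<lambda>Z. (dirD (\<lambda>q. g q (A Y) Z) (A p) (A X)
      + dirD (\<lambda>q. g q (A X) Z) (A p) (A Y) - dirD (\<lambda>q. g q (A X) (A Y)) (A p) Z) / 2"
  have L: "?L (A Z) = ?K Z" for Z
    using dirD_linear[OF lin, of "\<lambda>q. g q (A Y) (A Z)" "\<lambda>q. g q Y Z" p X]
      dirD_linear[OF lin, of "\<lambda>q. g q (A X) (A Z)" "\<lambda>q. g q X Z" p Y]
      dirD_linear[OF lin, of "\<lambda>q. g q (A X) (A Y)" "\<lambda>q. g q X Y" p Z]
    by (simp add: iso)
  define P where "P w \<longleftrightarrow> (\<forall>Z. g (A p) w Z = ?L Z)" for w
  define Q where "Q w \<longleftrightarrow> (\<forall>Z. g p w Z = ?K Z)" for w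
  have iff: "P (A w) \<longleftrightarrow> Q w" for w
  proof
    assume "P (A w)"
    then have "g (A p) (A w) (A Z) = ?L (A Z)" for Z
      unfolding P_def by (rule spec)
    then show "Q w"
      unfolding Q_def L iso by (rule allI)
  next
    assume *: "Q w"
    have "g (A p) (A w) Z = ?L Z" for Z
    proof -
      obtain Z' where Z: "Z = A Z'"
        using surjD[OF bij_is_surj[OF bij]] by blast
      show ?thesis
        unfolding Z L iso using *[unfolded Q_def] by (rule spec)
    qed
    then show "P (A w)"
      unfolding P_def by (rule allI)
  qed
  have P: "\<exists>!w. P w"
    unfolding P_def by (rule ex1)
  then obtain w where w: "P w"
    by (rule ex1E)
  obtain u where wu: "w = A u"
    using surjD[OF bij_is_surj[OF bij]] by blast
  have "(THE w. P w) = A u"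
    using P w unfolding wu by (rule the1_equality)
  moreover have "(THE w. Q w) = u"
  proof (rule the_equality)
    show "Q u"
      using w iff by (simp add: wu)
    show "w' = u" if "Q w'" for w'
    proof -
      have "A w' = A u"
        using P w that iff[of w'] by (auto simp: wu)
      then show ?thesis
        using bij by (simp add: bij_is_inj inj_eq)
    qed
  qed
  ultimately show ?thesis
    by (simp add: christ_def P_def Q_def)
qed

lemma curv4_linear_isometry:
  fixes g :: "'a::real_vector \<Rightarrow> 'a \<Rightarrow> 'a \<Rightarrow> real"
  assumes lin: "linear A" and bij: "bij A" and iso: "\<And>q X Y. g (A q) (A X) (A Y) = g q X Y"
    and ex1: "\<And>X Y. \<exists>!w. \<forall>Z. g (A p) w Z = (dirD (\<lambda>q. g q Y Z) (A p) X
      + dirD (\<lambda>q. g q X Z) (A p) Y - dirD (\<lambda>q. g q X Y) (A p) Z) / 2"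
  shows "curv4 g (A p) (A X) (A Y) (A Z) (A W) = curv4 g p X Y Z W"
proof -
  have "dirD2 (\<lambda>q. g q (A X) (A Y)) (A p) (A Z) (A W) = dirD2 (\<lambda>q. g q X Y) p Z W" for X Y Z W
    by (rule dirD2_linear[OF lin]) (rule iso)
  moreover have "christ g (A p) (A X) (A Y) = A (christ g p X Y)" for X Y
    by (rule christ_linear_isometry[OF lin bij iso ex1])
  ultimately show ?thesis
    by (simp add: curv4_def iso)
qed

section \<open>Linear maps preserving both forms, and triality\<close>

definition form_isometry :: "(oct \<times> oct \<Rightarrow> oct \<times> oct) \<Rightarrow> bool" where
  "form_isometry A \<longleftrightarrow> linear A \<and> (\<forall>X Y. hform (A X) (A Y) = hform X Y) \<and>
     (\<forall>V W X Y. pform (A V) (A W) (A X) (A Y) = pform V W X Y)"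

lemma form_isometry_compose:
  "form_isometry A \<Longrightarrow> form_isometry B \<Longrightarrow> form_isometry (A \<circ> B)"
  by (simp add: form_isometry_def linear_compose)

lemma form_isometry_id: "form_isometry id"
  by (simp add: form_isometry_def linear_id)

lemma form_isometry_bij:
  assumes "form_isometry A"
  shows "bij A"
proof (rule linear_bijI)
  fix X assume X: "A X = 0"
  have "hform X Z = hform (A X) (A Z)" for Z
    using assms by (simp add: form_isometry_def)
  then have "hform X Z = hform 0 Z" for Z
    by (simp add: X hform_def)
  then show "X = 0" by (rule hform_eqI)
qed (use assms in \<open>simp add: form_isometry_def\<close>)

lemma OP11_metric_form_isometry:
  "form_isometry A \<Longrightarrow> OP11_metric (A q) (A X) (A Y) = OP11_metric q X Y"
  by (simp add: OP11_metric_eq Dform_def form_isometry_def)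

text \<open>For a unit octonion \<open>a\<close> the first component is the Moufang product \<open>(a u) a\<close>, and
  \<open>((a u) a)((v a)*) = a (u v*)\<close>.\<close>
definition triality :: "oct \<Rightarrow> oct \<times> oct \<Rightarrow> oct \<times> oct" where
  "triality a X = ((2 * (a \<bullet> oconj (fst X))) *\<^sub>R a - oconj (fst X), snd X \<odot> a)"

text \<open>Both components transform orthogonally, the first by conjugation followed by the
  negative of a reflection. All products \<open>X1 Y2*\<close> get the same unit factor
  \<open>a\<close> on the left, so their inner products survive.\<close>

lemma form_isometry_triality:
  assumes a: "a \<bullet> a = 1"
  shows "form_isometry (triality a)"
proof -
  have "linear (triality a)"
    by (rule linearI) (simp_all add: triality_def omul_bilinear inner_add algebra_simps)
  moreover have fst: "fst (triality a X) \<bullet> fst (triality a Y) = fst X \<bullet> fst Y" for X Y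
  proof -
    have "((2 * (a \<bullet> u)) *\<^sub>R a - u) \<bullet> ((2 * (a \<bullet> w)) *\<^sub>R a - w) = u \<bullet> w" for u w
      by (simp add: inner_diff_left inner_diff_right a inner_commute[of u a])
    then show ?thesis
      by (simp add: triality_def inner_oconj)
  qed
  moreover have snd: "snd (triality a X) \<bullet> snd (triality a Y) = snd X \<bullet> snd Y" for X Y
    using a by (simp add: triality_def inner_omul_omul_right)
  moreover have "fst (triality a X) \<odot> oconj (snd (triality a Y)) = a \<odot> (fst X \<odot> oconj (snd Y))" for X Y
  proof -
    let ?y = "oconj (snd Y)"
    have "fst (triality a X) \<odot> oconj (snd (triality a Y))
        = (2 * (a \<bullet> oconj (fst X))) *\<^sub>R ?y - oconj (fst X) \<odot> (oconj a \<odot> ?y)"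
      using oconj_omul_cancel[of "oconj a" ?y] a
      by (simp add: triality_def omul_bilinear oconj_omul oconj_oconj inner_oconj)
    also have "\<dots> = a \<odot> (fst X \<odot> ?y)"
      using oconj_omul_exchange[of "fst X" "oconj a" ?y] inner_oconj[of a "oconj (fst X)"]
      by (simp add: oconj_oconj inner_commute algebra_simps)
    finally show ?thesis .
  qed
  ultimately show ?thesis
    using a by (simp add: form_isometry_def hform_def pform_def inner_omul_omul_left
        flip: omul_add_right)
qed

lemma ex_form_isometry_fst_real: "\<exists>A r v. form_isometry A \<and> A q = (r *\<^sub>R o1, v)"
proof -
  define w where "w = oconj (fst q)"
  \<comment> \<open>\<open>b\<close> bisects the angle between \<open>w\<close> and
    \<open>norm w *\<^sub>R o1\<close>, so the map \<open>2<a,w> a - w\<close> with \<open>a\<close>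
    along \<open>b\<close> sends one to the other. If \<open>b = 0\<close>, then \<open>w\<close> is
    already real.\<close>
  define b where "b = w + norm w *\<^sub>R o1"
  show ?thesis
  proof (cases "b = 0")
    case True
    then have "w = (- norm w) *\<^sub>R o1"
      unfolding b_def add_eq_0_iff2 by (simp only: scaleR_minus_left)
    then obtain k where "w = k *\<^sub>R o1"
      by blast
    then have "fst q = k *\<^sub>R o1"
      using oconj_oconj[of "fst q"] by (simp add: oconj_scaleR flip: w_def)
    then have "id q = (k *\<^sub>R o1, snd q)"
      by (simp add: prod_eq_iff)
    then show ?thesis
      using form_isometry_id by blast
  next
    case False
    define a where "a = (1 / norm b) *\<^sub>R b"
    have a: "a \<bullet> a = 1"
      using False by (simp add: a_def dot_square_norm power2_eq_square)
    have "b \<bullet> b = 2 * (b \<bullet> w)"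
      by (simp add: b_def inner_add inner_commute power2_norm_eq_inner algebra_simps flip: power2_eq_square)
    then have "2 * (b \<bullet> w) / (norm b)\<^sup>2 = 1"
      using False by (metis divide_self inner_eq_zero_iff power2_norm_eq_inner)
    moreover have "(2 * (a \<bullet> w)) *\<^sub>R a = (2 * (b \<bullet> w) / (norm b)\<^sup>2) *\<^sub>R b"
      by (simp add: a_def power2_eq_square)
    ultimately have ab: "(2 * (a \<bullet> w)) *\<^sub>R a = b"
      by (simp only: scaleR_one)
    have "triality a q = (norm w *\<^sub>R o1, snd q \<odot> a)"
      unfolding triality_def w_def[symmetric] ab unfolding b_def by simp
    then show ?thesis
      using form_isometry_triality[OF a] by blast
  qed
qed

lemma ex_unit_imaginary_orthogonal:
  fixes v :: oct
  shows "\<exists>a. a \<bullet> a = 1 \<and> a \<bullet> o1 = 0 \<and> a \<bullet> v = 0"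
proof -
  have "dim {o1, v} \<le> card {o1, v}"
    by (rule dim_le_card') simp
  also have "\<dots> \<le> 2"
    by (simp add: card_insert_le_m1)
  also have "2 < DIM(oct)"
    by simp
  finally obtain b where b: "b \<noteq> 0" "\<And>y. y \<in> span {o1, v} \<Longrightarrow> orthogonal b y"
    using orthogonal_to_subspace_exists[of "{o1, v}"] by blast
  have "b \<bullet> o1 = 0" "b \<bullet> v = 0"
    using b(2) by (simp_all add: span_base flip: orthogonal_def)
  moreover have "((1 / norm b) *\<^sub>R b) \<bullet> ((1 / norm b) *\<^sub>R b) = 1"
    using b(1) by (simp add: dot_square_norm power2_eq_square)
  ultimately show ?thesis
    by (intro exI[of _ "(1 / norm b) *\<^sub>R b"]) simp
qed

text \<open>With \<open>a\<close> imaginary, the first coordinate stays real while the second is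
  multiplied by \<open>a\<close>.\<close>

lemma triality_real:
  assumes "a \<bullet> o1 = 0"
  shows "triality a (r *\<^sub>R o1, v) = ((- r) *\<^sub>R o1, v \<odot> a)"
  using assms by (simp add: triality_def oconj_scaleR)

lemma ex_form_isometry_real: "\<exists>A r s. form_isometry A \<and> A q = real_pt r s"
proof -
  obtain A r v where A: "form_isometry A" "A q = (r *\<^sub>R o1, v)"
    using ex_form_isometry_fst_real by blast
  \<comment> \<open>This choice makes \<open>v \<odot> a\<close> imaginary. The next multiplier, its
    normalised conjugate, is then imaginary too and makes the second coordinate real without
    spoiling the first.\<close>
  obtain a where a: "a \<bullet> a = 1" "a \<bullet> o1 = 0" "a \<bullet> v = 0"
    using ex_unit_imaginary_orthogonal by blast
  define w where "w = v \<odot> a"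
  have w0: "w \<bullet> o1 = 0"
    using a by (simp add: w_def inner_omul_right oconj_eq inner_diff_right inner_commute[of v])
  define B where "B = triality a \<circ> A"
  have B: "form_isometry B" "B q = ((- r) *\<^sub>R o1, w)"
    using form_isometry_compose[OF form_isometry_triality[OF a(1)] A(1)] A(2) triality_real[OF a(2)]
    by (simp_all add: B_def w_def)
  show ?thesis
  proof (cases "w = 0")
    case True
    then have "B q = real_pt (- r) 0" by (simp add: B real_pt_def)
    then show ?thesis using B(1) by blast
  next
    case False
    define b where "b = (1 / norm w) *\<^sub>R oconj w"
    have b: "b \<bullet> b = 1"
      using False by (simp add: b_def inner_oconj) (simp add: dot_square_norm power2_eq_square)
    have "b \<bullet> o1 = 0"
      using w0 inner_oconj[of w o1] by (simp add: b_def)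
    moreover have "w \<odot> b = norm w *\<^sub>R o1"
      using False by (simp add: b_def omul_bilinear omul_oconj_self dot_square_norm power2_eq_square)
    ultimately have "(triality b \<circ> B) q = real_pt r (norm w)"
      using triality_real[of b "- r" w] by (simp add: B real_pt_def)
    then show ?thesis
      using form_isometry_compose[OF form_isometry_triality[OF b] B(1)] by blast
  qed
qed

lemma ex_model_frame:
  assumes "Dform p > 0"
  shows "\<exists>F. model_frame p F"
proof -
  obtain A r s where A: "form_isometry A" "A p = real_pt r s"
    using ex_form_isometry_real by blast
  have D: "Dform (real_pt r s) > 0"
    using assms A unfolding A(2)[symmetric] by (simp add: Dform_def form_isometry_def)
  have lin: "linear A" using A(1) by (simp add: form_isometry_def)
  note bij = form_isometry_bij[OF A(1)]
  have "curv4 OP11_metric (A p) (A X) (A Y) (A Z) (A W) = curv4 OP11_metric p X Y Z W" for X Y Z W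
    using OP11_metric_form_isometry[OF A(1)] ex1_christ_real_pt[OF D]
    unfolding A(2)[symmetric] by (rule curv4_linear_isometry[OF lin bij])
  from this[symmetric] have "model_frame p (real_frame r s \<circ> A)"
    using model_frame_real_pt[OF D] lin bij OP11_metric_form_isometry[OF A(1), of p]
    unfolding model_frame_def A(2)[symmetric] by (simp add: linear_compose bij_comp)
  then show ?thesis by blast
qed

subsection \<open>The model Jacobi operator\<close>

lemma oct_pair_eq_iff: "X = Y \<longleftrightarrow> fst X = fst Y \<and> snd X = snd Y" for X Y :: "oct \<times> oct"
  by (rule prod_eq_iff)

lemma o1_neq_0 [simp]: "o1 \<noteq> 0"
  using inner_o1_o1 by fastforce

definition line_op :: "oct \<times> oct \<Rightarrow> oct \<times> oct \<Rightarrow> oct \<times> oct" where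
  "line_op V X = ((fst V \<bullet> fst V) *\<^sub>R fst X - (fst V \<odot> oconj (snd V)) \<odot> snd X,
     (snd V \<odot> oconj (fst V)) \<odot> fst X - (snd V \<bullet> snd V) *\<^sub>R snd X)"

lemma oconj_swap: "oconj (a \<odot> oconj b) = b \<odot> oconj a"
  by (simp add: oconj_omul oconj_oconj)

lemma omul_oconj_cancel': "(b \<odot> oconj a) \<odot> a = (a \<bullet> a) *\<^sub>R b"
  using omul_oconj_cancel[of b "oconj a"] by (simp add: oconj_oconj inner_oconj)

lemma inner_omul_self: "(a \<odot> b) \<bullet> (a \<odot> b) = (a \<bullet> a) * (b \<bullet> b)"
  by (rule inner_omul_omul_left)

lemma omul_swap_cancel:
  "(b \<odot> oconj a) \<odot> ((a \<odot> oconj b) \<odot> c) = ((a \<bullet> a) * (b \<bullet> b)) *\<^sub>R c"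
  using oconj_omul_cancel[of "a \<odot> oconj b" c] by (simp add: oconj_swap inner_omul_self inner_oconj)

lemma line_op_linear:
  "line_op V (X + Y) = line_op V X + line_op V Y" "line_op V (X - Y) = line_op V X - line_op V Y"
  "line_op V (k *\<^sub>R X) = k *\<^sub>R line_op V X"
  by (simp_all add: line_op_def omul_bilinear algebra_simps)

lemma hform_line_op: "hform (line_op V X) Y = pform V V X Y"
proof -
  have 1: "((fst V \<odot> oconj (snd V)) \<odot> snd X) \<bullet> fst Y = (fst V \<odot> oconj (snd V)) \<bullet> (fst Y \<odot> oconj (snd X))"
    by (rule inner_omul_right)
  have 2: "((snd V \<odot> oconj (fst V)) \<odot> fst X) \<bullet> snd Y = (fst V \<odot> oconj (snd V)) \<bullet> (fst X \<odot> oconj (snd Y))"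
    using inner_oconj[of "snd V \<odot> oconj (fst V)" "snd Y \<odot> oconj (fst X)"]
    by (simp add: inner_omul_right oconj_swap)
  show ?thesis
    unfolding hform_def line_op_def fst_conv snd_conv inner_diff_left 1 2
    by (simp add: pform_def inner_add algebra_simps)
qed

lemma hform_line_op_commute: "hform (line_op V X) Y = hform X (line_op V Y)"
  by (simp add: hform_line_op hform_commute[of X] pform_commute(2)[of V V X])

lemma line_op_self: "line_op V V = hform V V *\<^sub>R V"
  by (simp add: line_op_def hform_def oct_pair_eq_iff omul_oconj_cancel' algebra_simps)

lemma line_op_line_op: "line_op V (line_op V X) = hform V V *\<^sub>R line_op V X"
  by (simp add: line_op_def hform_def oct_pair_eq_iff omul_bilinear omul_swap_cancel algebra_simps)

lemma hform_line_op_self: "hform V (line_op V X) = hform V V * hform V X"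
  using hform_line_op_commute[of V V X] by (simp add: line_op_self hform_bilinear)

text \<open>For \<open>fst V\<close> nonzero the line is a graph \<open>W2 = m W1 / n\<close> with
  \<open>m = V2 V1*\<close> and \<open>n = |V1|^2\<close>. Right cancellation makes
  \<open>W2 W1*\<close> a real multiple of \<open>m\<close>, so \<open>line_op W\<close> depends on
  \<open>W\<close> only up to a real factor. Otherwise the line is \<open>W1 = 0\<close>.\<close>

lemma line_op_line:
  assumes V: "hform V V \<noteq> 0" and W: "line_op V W = hform V V *\<^sub>R W"
  shows "\<exists>k. \<forall>X. line_op W X = k *\<^sub>R line_op V X"
proof (cases "fst V = 0")
  case True
  have "fst (line_op V W) = 0" by (simp add: line_op_def True)
  then have "fst W = 0" using W V by (simp add: oct_pair_eq_iff)
  moreover have "snd V \<bullet> snd V \<noteq> 0" using V True by (simp add: hform_def)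
  ultimately have "line_op W X = ((snd W \<bullet> snd W) / (snd V \<bullet> snd V)) *\<^sub>R line_op V X" for X
    using True by (simp add: line_op_def)
  then show ?thesis by blast
next
  case False
  define n where "n = fst V \<bullet> fst V"
  have n: "n \<noteq> 0" using False by (simp add: n_def)
  let ?m = "snd V \<odot> oconj (fst V)"
  have "snd (line_op V W) = hform V V *\<^sub>R snd W" by (simp add: W)
  then have "?m \<odot> fst W = n *\<^sub>R snd W"
    by (simp add: line_op_def hform_def n_def algebra_simps)
  then have snd: "snd W = (1 / n) *\<^sub>R (?m \<odot> fst W)" using n by simp
  define k where "k = (fst W \<bullet> fst W) / n"
  have 1: "fst W \<bullet> fst W = k * n" using n by (simp add: k_def)
  have 2: "snd W \<odot> oconj (fst W) = k *\<^sub>R ?m"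
    by (simp add: snd k_def omul_bilinear omul_oconj_cancel)
  have 3: "fst W \<odot> oconj (snd W) = k *\<^sub>R (fst V \<odot> oconj (snd V))"
    using arg_cong[OF 2, of oconj] by (simp add: oconj_swap oconj_scaleR)
  have 4: "snd W \<bullet> snd W = k * (snd V \<bullet> snd V)"
    using n by (simp add: snd k_def inner_omul_self inner_oconj flip: n_def)
  have "line_op W X = k *\<^sub>R line_op V X" for X
    unfolding line_op_def 1 2 3 4 by (simp add: n_def omul_bilinear algebra_simps)
  then show ?thesis by blast
qed

lemma line_op_eq_0_commute:
  assumes V: "hform V V \<noteq> 0" and W: "line_op V W = 0"
  shows "line_op W V = 0"
proof (cases "fst V = 0")
  case True
  have "snd (line_op V W) = - ((snd V \<bullet> snd V) *\<^sub>R snd W)" by (simp add: line_op_def True)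
  moreover have "snd V \<bullet> snd V \<noteq> 0" using V True by (simp add: hform_def)
  ultimately have "snd W = 0" using W by simp
  then show ?thesis by (simp add: line_op_def True oct_pair_eq_iff)
next
  case False
  define n where "n = fst V \<bullet> fst V"
  have n: "n \<noteq> 0" using False by (simp add: n_def)
  let ?m = "fst V \<odot> oconj (snd V)"
  have "fst (line_op V W) = 0" by (simp add: W)
  then have "?m \<odot> snd W = n *\<^sub>R fst W" by (simp add: line_op_def n_def)
  then have fst: "fst W = (1 / n) *\<^sub>R (?m \<odot> snd W)" using n by simp
  define k where "k = (snd W \<bullet> snd W) / n"
  have 1: "snd W \<bullet> snd W = k * n" using n by (simp add: k_def)
  have 2: "fst W \<odot> oconj (snd W) = k *\<^sub>R ?m"
    by (simp add: fst k_def omul_bilinear omul_oconj_cancel)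
  have 3: "snd W \<odot> oconj (fst W) = k *\<^sub>R (snd V \<odot> oconj (fst V))"
    using arg_cong[OF 2, of oconj] by (simp add: oconj_swap oconj_scaleR)
  have 4: "fst W \<bullet> fst W = k * (snd V \<bullet> snd V)"
    using n by (simp add: fst k_def inner_omul_self inner_oconj flip: n_def)
  show ?thesis
    unfolding line_op_def 1 2 3 4 by (simp add: n_def omul_bilinear omul_oconj_cancel' oct_pair_eq_iff)
qed

lemma ex_line_op_neq_0:
  assumes V: "hform V V \<noteq> 0"
  shows "\<exists>X. hform V X = 0 \<and> line_op V X \<noteq> 0"
proof (cases "fst V = 0")
  case True
  then have "snd V \<bullet> snd V \<noteq> 0" using V by (simp add: hform_def)
  moreover obtain y where "y \<bullet> y = 1" "y \<bullet> snd V = 0"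
    using ex_unit_imaginary_orthogonal by blast
  ultimately show ?thesis
    by (intro exI[of _ "(0, y)"]) (auto simp: line_op_def hform_def inner_commute oct_pair_eq_iff)
next
  case False
  obtain y where "y \<bullet> y = 1" "y \<bullet> fst V = 0"
    using ex_unit_imaginary_orthogonal by blast
  with False show ?thesis
    by (intro exI[of _ "(y, 0)"]) (auto simp: line_op_def hform_def inner_commute oct_pair_eq_iff)
qed

lemma ex_line_op_eq_0:
  assumes V: "hform V V \<noteq> 0"
  shows "\<exists>X. X \<noteq> 0 \<and> line_op V X = 0"
proof (cases "fst V = 0")
  case True
  then show ?thesis
    by (intro exI[of _ "(o1, 0)"]) (simp add: line_op_def oct_pair_eq_iff)
next
  case False
  define n where "n = fst V \<bullet> fst V"
  have n: "n \<noteq> 0" using False by (simp add: n_def)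
  \<comment> \<open>The witness solves the first component equation with second coordinate
    \<open>o1\<close>.\<close>
  have "line_op V ((1 / n) *\<^sub>R (fst V \<odot> oconj (snd V)), o1) = 0"
    using n omul_swap_cancel[of "snd V" "fst V" o1]
    by (simp add: line_op_def oct_pair_eq_iff omul_bilinear flip: n_def)
  then show ?thesis
    by (intro exI[of _ "((1 / n) *\<^sub>R (fst V \<odot> oconj (snd V)), o1)"]) (simp add: oct_pair_eq_iff)
qed

definition model_jacobi :: "oct \<times> oct \<Rightarrow> oct \<times> oct \<Rightarrow> oct \<times> oct" where
  "model_jacobi V X = hform V V *\<^sub>R X - (4 * hform V X) *\<^sub>R V + 3 *\<^sub>R line_op V X"

lemma hform_model_jacobi: "hform (model_jacobi V X) W = model_curv V X W"
  by (simp add: model_jacobi_def model_curv_def hform_bilinear hform_line_op)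

text \<open>The coefficients 1, -4 and 3 add up to 0. Hence eigenvectors for nonzero eigenvalues are
  orthogonal to \<open>V\<close>, and the rank-one term disappears on them.\<close>

lemma hform_model_jacobi_self: "hform V (model_jacobi V X) = 0"
  by (simp add: model_jacobi_def hform_bilinear hform_line_op_self)

lemma model_jacobi_eq_mu_iff:
  assumes V: "hform V V \<noteq> 0"
  shows "model_jacobi V X = hform V V *\<^sub>R X \<longleftrightarrow> line_op V X = 0"
proof
  assume *: "model_jacobi V X = hform V V *\<^sub>R X"
  then have "hform V V * hform V X = 0"
    using hform_model_jacobi_self[of V X] by (simp add: hform_bilinear)
  then show "line_op V X = 0"
    using * V by (simp add: model_jacobi_def)
next
  assume *: "line_op V X = 0"
  then have "hform V X = 0"
    using hform_line_op_self[of V X] V by (simp add: hform_def[of _ 0])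
  with * show "model_jacobi V X = hform V V *\<^sub>R X"
    by (simp add: model_jacobi_def)
qed

lemma model_jacobi_eq_lam_iff:
  assumes V: "hform V V \<noteq> 0"
  shows "model_jacobi V X = (hform V V * 4) *\<^sub>R X \<longleftrightarrow> line_op V X = hform V V *\<^sub>R X \<and> hform V X = 0"
proof
  assume *: "model_jacobi V X = (hform V V * 4) *\<^sub>R X"
  then have h: "hform V X = 0"
    using hform_model_jacobi_self[of V X] V by (simp add: hform_bilinear)
  have "3 *\<^sub>R line_op V X = 3 *\<^sub>R (hform V V *\<^sub>R X)"
  proof -
    have "3 *\<^sub>R line_op V X = (hform V V * 4) *\<^sub>R X - hform V V *\<^sub>R X"
      using * h by (simp add: model_jacobi_def eq_diff_eq add.commute)
    then show ?thesis
      by (simp flip: scaleR_left_diff_distrib)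
  qed
  then have "line_op V X = hform V V *\<^sub>R X"
    by (simp only: scaleR_cancel_left) simp
  with h show "line_op V X = hform V V *\<^sub>R X \<and> hform V X = 0" by simp
next
  assume "line_op V X = hform V V *\<^sub>R X \<and> hform V X = 0"
  then show "model_jacobi V X = (hform V V * 4) *\<^sub>R X"
    by (simp add: model_jacobi_def flip: scaleR_left_distrib)
qed

section \<open>The Osserman conditions read in a model frame\<close>

lemma model_frame_jacobi:
  assumes F: "model_frame p F"
  shows "F (jacobi OP11_metric p v x) = model_jacobi (F v) (F x)"
proof -
  have bij: "bij F" and g: "\<And>X Y. OP11_metric p X Y = hform (F X) (F Y)"
    and c: "\<And>V X W. curv4 OP11_metric p V X V W = model_curv (F V) (F X) (F W)"
    using F by (simp_all add: model_frame_def)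
  obtain w where w: "F w = model_jacobi (F v) (F x)"
    using bij_is_surj[OF bij] by (metis surjD)
  have "jacobi OP11_metric p v x = w"
    unfolding jacobi_def curvop_def
  proof (rule the_equality)
    show 1: "\<forall>W. OP11_metric p w W = curv4 OP11_metric p v x v W"
      by (simp add: g c w hform_model_jacobi)
    show "w' = w" if "\<forall>W. OP11_metric p w' W = curv4 OP11_metric p v x v W" for w'
      using 1 that by (intro OP11_metric_eqI[OF bij g]) simp
  qed
  with w show ?thesis by simp
qed

context
  fixes p F
  assumes F: "model_frame p F"
begin

lemma frame_linear: "F (x + y) = F x + F y" "F (x - y) = F x - F y" "F (k *\<^sub>R x) = k *\<^sub>R F x"
  using F by (simp_all add: model_frame_def linear_add linear_diff linear_scale)

lemma frame_eq_iff: "F x = F y \<longleftrightarrow> x = y"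
  using F by (simp add: model_frame_def bij_is_inj inj_eq)

lemma frame_eq_0_iff: "F x = 0 \<longleftrightarrow> x = 0"
  using frame_eq_iff[of x 0] F by (simp add: model_frame_def linear_0)

lemma frame_surj: obtains x where "F x = X"
  using F by (metis model_frame_def bij_pointE)

lemma frame_metric: "OP11_metric p x y = hform (F x) (F y)"
  using F by (simp add: model_frame_def)

lemma frame_unitv: "unitv OP11_metric p v \<Longrightarrow> hform (F v) (F v) \<noteq> 0"
  by (auto simp: unitv_def frame_metric)

lemma frame_eigsp: "x \<in> eigsp OP11_metric p v c \<longleftrightarrow> model_jacobi (F v) (F x) = c *\<^sub>R F x"
  using frame_eq_iff[of "jacobi OP11_metric p v x" "c *\<^sub>R x"]
  by (simp add: eigsp_def frame_linear model_frame_jacobi[OF F])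

lemma frame_eigsp_lam:
  assumes "unitv OP11_metric p v"
  shows "x \<in> eigsp OP11_metric p v (OP11_metric p v v * 4) \<longleftrightarrow>
    line_op (F v) (F x) = hform (F v) (F v) *\<^sub>R F x \<and> hform (F v) (F x) = 0"
  unfolding frame_eigsp frame_metric by (rule model_jacobi_eq_lam_iff[OF frame_unitv[OF assms]])

lemma frame_eigsp_mu:
  assumes "unitv OP11_metric p v"
  shows "x \<in> eigsp OP11_metric p v (OP11_metric p v v * 1) \<longleftrightarrow> line_op (F v) (F x) = 0"
  using model_jacobi_eq_mu_iff[OF frame_unitv[OF assms]] by (simp add: frame_eigsp frame_metric)

text \<open>Adding \<open>v\<close> to its orthogonal eigenspace fills out the whole octonionic
  line, the image of the projection.\<close>

lemma frame_Elam:
  assumes v: "unitv OP11_metric p v"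
  shows "y \<in> Elam OP11_metric p 4 v \<longleftrightarrow> line_op (F v) (F y) = hform (F v) (F v) *\<^sub>R F y"
proof
  assume "y \<in> Elam OP11_metric p 4 v"
  then obtain a x where "y = a *\<^sub>R v + x" "x \<in> eigsp OP11_metric p v (OP11_metric p v v * 4)"
    by (auto simp: Elam_def)
  then show "line_op (F v) (F y) = hform (F v) (F v) *\<^sub>R F y"
    unfolding frame_eigsp_lam[OF v]
    by (simp add: frame_linear line_op_linear line_op_self algebra_simps)
next
  assume y: "line_op (F v) (F y) = hform (F v) (F v) *\<^sub>R F y"
  \<comment> \<open>The coefficient of the orthogonal projection of \<open>y\<close> to
    \<open>v\<close>.\<close>
  define a where "a = hform (F v) (F y) / hform (F v) (F v)"
  have "y - a *\<^sub>R v \<in> eigsp OP11_metric p v (OP11_metric p v v * 4)"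
    using frame_unitv[OF v] unfolding frame_eigsp_lam[OF v]
    by (simp add: frame_linear line_op_linear line_op_self y hform_bilinear a_def algebra_simps)
  moreover have "y = a *\<^sub>R v + (y - a *\<^sub>R v)" by simp
  ultimately show "y \<in> Elam OP11_metric p 4 v"
    unfolding Elam_def by blast
qed

lemma frame_osserman_I:
  assumes v: "unitv OP11_metric p v"
  shows "osserman_I OP11_metric p 4 1 v"
proof -
  note e0 = frame_unitv[OF v]
  define e where "e = hform (F v) (F v)"
  have ee: "e * e = 1" using v by (auto simp: e_def unitv_def frame_metric)
  define A where "A = eigsp OP11_metric p v (OP11_metric p v v * 4) \<inter> vperp OP11_metric p v"
  define B where "B = eigsp OP11_metric p v (OP11_metric p v v * 1) \<inter> vperp OP11_metric p v"
  have A: "y \<in> A \<longleftrightarrow> line_op (F v) (F y) = e *\<^sub>R F y \<and> hform (F v) (F y) = 0" for y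
    unfolding A_def Int_iff frame_eigsp_lam[OF v] by (auto simp: vperp_def frame_metric e_def)
  have B: "z \<in> B \<longleftrightarrow> line_op (F v) (F z) = 0" for z
  proof -
    have "line_op (F v) (F z) = 0 \<Longrightarrow> hform (F v) (F z) = 0"
      using hform_line_op_self[of "F v" "F z"] e0 by (simp add: hform_def[of _ 0])
    then show ?thesis
      unfolding B_def Int_iff frame_eigsp_mu[OF v] by (auto simp: vperp_def frame_metric)
  qed
  \<comment> \<open>As \<open>e * e = 1\<close>, \<open>e\<close> times \<open>line_op\<close> is
    idempotent; it splits the complement of \<open>v\<close> into the two eigenspaces.\<close>
  have split: "\<exists>y. y \<in> A \<and> x - y \<in> B \<and> F y = e *\<^sub>R line_op (F v) (F x)"
    if x: "hform (F v) (F x) = 0" for x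
  proof -
    obtain y where y: "F y = e *\<^sub>R line_op (F v) (F x)" by (rule frame_surj)
    have "line_op (F v) (F y) = e *\<^sub>R F y"
      by (simp add: y line_op_linear line_op_line_op e_def)
    moreover have "hform (F v) (F y) = 0"
      by (simp add: y hform_bilinear hform_line_op_self x)
    moreover have "line_op (F v) (F (x - y)) = 0"
      using ee by (simp add: frame_linear line_op_linear y line_op_line_op flip: e_def)
    ultimately show ?thesis
      using y A B by blast
  qed
  have "\<exists>y z. y \<in> A \<and> z \<in> B \<and> x = y + z" if "x \<in> vperp OP11_metric p v" for x
  proof -
    have "hform (F v) (F x) = 0"
      using that by (simp add: vperp_def frame_metric)
    then obtain y where "y \<in> A" "x - y \<in> B"
      using split by blast
    moreover have "x = y + (x - y)" by simp
    ultimately show ?thesis by blast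
  qed
  moreover have "\<exists>y\<in>A. y \<noteq> 0"
  proof -
    obtain X where X: "hform (F v) X = 0" "line_op (F v) X \<noteq> 0"
      using ex_line_op_neq_0[OF e0] by blast
    obtain x where x: "F x = X" by (rule frame_surj)
    obtain y where y: "y \<in> A" "F y = e *\<^sub>R line_op (F v) X"
      using split[of x] X x by blast
    have "F y \<noteq> 0" using X e0 by (simp add: y e_def)
    then show ?thesis using y(1) by (auto simp: frame_eq_0_iff)
  qed
  moreover have "\<exists>z\<in>B. z \<noteq> 0"
  proof -
    obtain X where X: "X \<noteq> 0" "line_op (F v) X = 0"
      using ex_line_op_eq_0[OF e0] by blast
    obtain x where x: "F x = X" by (rule frame_surj)
    have "x \<in> B" "x \<noteq> 0"
      using X x frame_eq_0_iff[of x] by (simp_all add: B)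
    then show ?thesis ..
  qed
  ultimately show ?thesis
    unfolding osserman_I_def Let_def A_def B_def by blast
qed

lemma frame_Elam_eq:
  assumes v: "unitv OP11_metric p v" and w: "unitv OP11_metric p w" "w \<in> Elam OP11_metric p 4 v"
  shows "Elam OP11_metric p 4 w = Elam OP11_metric p 4 v"
proof -
  define e where "e = hform (F v) (F v)"
  have e0: "e \<noteq> 0" using frame_unitv[OF v] by (simp add: e_def)
  have W: "line_op (F v) (F w) = e *\<^sub>R F w"
    using w(2) unfolding frame_Elam[OF v] e_def .
  then obtain k where k: "\<And>X. line_op (F w) X = k *\<^sub>R line_op (F v) X"
    using line_op_line[of "F v" "F w"] e0 unfolding e_def by blast
  \<comment> \<open>Evaluating the operator of \<open>w\<close> on \<open>w\<close> in two ways
    identifies \<open>k\<close> and shows that it is nonzero.\<close>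
  have "hform (F w) (F w) *\<^sub>R F w = (k * e) *\<^sub>R F w"
    unfolding line_op_self[symmetric] k W by (rule scaleR_scaleR)
  moreover have "F w \<noteq> 0"
    using frame_unitv[OF w(1)] by (auto simp: hform_def)
  ultimately have ke: "hform (F w) (F w) = k * e"
    by (simp only: scaleR_cancel_right) simp
  then have "k \<noteq> 0"
    using frame_unitv[OF w(1)] by auto
  then have iff: "k *\<^sub>R line_op (F v) (F y) = (k * e) *\<^sub>R F y \<longleftrightarrow> line_op (F v) (F y) = e *\<^sub>R F y" for y
    by (simp flip: scaleR_scaleR)
  show ?thesis
  proof (rule set_eqI)
    show "y \<in> Elam OP11_metric p 4 w \<longleftrightarrow> y \<in> Elam OP11_metric p 4 v" for y
      unfolding frame_Elam[OF v] frame_Elam[OF w(1)] k ke unfolding e_def[symmetric] by (rule iff)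
  qed
qed

lemma frame_eigsp_mu_commute:
  assumes v: "unitv OP11_metric p v" and w: "unitv OP11_metric p w"
    and "w \<in> eigsp OP11_metric p v (OP11_metric p v v * 1)"
  shows "v \<in> eigsp OP11_metric p w (OP11_metric p w w * 1)"
  using assms(3) line_op_eq_0_commute[OF frame_unitv[OF v]]
  unfolding frame_eigsp_mu[OF v] frame_eigsp_mu[OF w] by blast

end

theorem theorem9p4:
  shows "special_osserman OP11_metric OP11_dom"
  unfolding special_osserman_def
\<comment> \<open>The eigenvalue 4 belongs to the octonionic line, 1 to its orthogonal
  complement.\<close>
proof (rule exI[of _ 4], rule exI[of _ 1], intro conjI ballI allI impI)
  fix p v assume "p \<in> OP11_dom" and v: "unitv OP11_metric p v"
  then have "Dform p > 0"
    by (simp add: OP11_dom_eq)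
  from ex_model_frame[OF this] obtain F where F: "model_frame p F" ..
  show "osserman_I OP11_metric p 4 1 v"
    by (rule frame_osserman_I[OF F v])
  show "Elam OP11_metric p 4 w = Elam OP11_metric p 4 v"
    if "unitv OP11_metric p w \<and> w \<in> Elam OP11_metric p 4 v" for w
    using frame_Elam_eq[OF F v] that by blast
  show "v \<in> eigsp OP11_metric p w (OP11_metric p w w * 1)"
    if "unitv OP11_metric p w \<and> w \<in> eigsp OP11_metric p v (OP11_metric p v v * 1)" for w
    using frame_eigsp_mu_commute[OF F v] that by blast
qed simp_all

end
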